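(* Let $p\in[0,1)$, $\lambda>0$, and let $(\mu_t)_{t\ge0}$ be the continuous-time Derrida--Retaux model with initial distribution $\mu_0=p\,\delta_0+(1-p)\lambda e^{-\lambda x}\mathbf 1_{\{x>0\}}dx$. Let $F_\infty(p,\lambda)=\lim_{t\to\infty}e^{-t}\int_0^\infty x\,\mu_t(dx)$. (i) If $(p,\lambda)\in\mathscr P$, then $F_\infty(p,\lambda)>0$. (ii) If $(p,\lambda)\in\mathscr U$, then there exists a constant $C>0$ such that $$\int_0^\infty y\,\mu_t(dy)\sim C e^{-(x-1)t}\qquad\text{as }t\to\infty,$$ where $x$ is the unique solution larger than $1$ of the equation $Hx-x\log x=1$, with $H=\frac p\lambda+\log\lambda$. (iii) If $(p,\lambda)\in\mathscr C$, then $$\int_0^\infty y\,\mu_t(dy)\sim\frac{2}{t^2}\qquad\text{as }t\to\infty .$$ Furthermore, conditionally on $(0,\infty)$, $\mu_t$ converges weakly to a standard exponential distribution, i.e. $\mu_t(\,\cdot\,\cap(0,\infty))/\mu_t((0,\infty))$ converges weakly as $t\to\infty$ to the exponential distribution of parameter $1$.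
   Context: $f(t)\sim g(t)$ means $f(t)/g(t)\to1$. The sets of parameters are $\mathscr P=\{(p,\lambda)\in[0,1)\times[0,\infty):\lambda<1\text{ or }(\lambda\ge1\text{ and }p<\lambda-\lambda\log\lambda)\}$, $\mathscr C=\{(p,\lambda)\in[0,1)\times[1,\infty):p=\lambda-\lambda\log\lambda\}$, $\mathscr U=\{(p,\lambda)\in[0,1)\times[1,\infty):p>\lambda-\lambda\log\lambda\}$. A continuous-time Derrida--Retaux (DR) model with initial law $\mu_0$ (a probability distribution on $\mathbb{R}_+=[0,\infty)$) is a weakly continuous family $(\mu_t)_{t\ge0}$ of probability distributions on $\mathbb{R}$, starting from $\mu_0$, which is a weak solution of $\partial_t\mu_t=\partial_x(\mathbf 1_{\{x>0\}}\mu_t)+\mu_t*\mu_t-\mu_t$, meaning that for every bounded $\mathcal C^1$ function $f$ with bounded derivative and every $t>0$, $$\int_{\mathbb{R}} f\,d\mu_t-\int_{\mathbb{R}} f\,d\mu_0=\int_0^t\Big(-\int_{\mathbb{R}}\big(f'(x)\mathbf 1_{\{x>0\}}+f(x)\big)\mu_s(dx)+\int_{\mathbb{R}^2}f(x+y)\mu_s(dx)\mu_s(dy)\Big)ds .$$ For each $\mu_0$ on $\mathbb{R}_+$ there is exactly one DR model with initial law $\mu_0$, and it is supported on $\mathbb{R}_+$. *)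

theory Defs
  imports "HOL-Probability.Probability" "HOL-Library.Landau_Symbols"
begin

(* The library's weak_conv_m is restricted to sequences; this is weak convergence along an
   arbitrary filter, tested against bounded continuous functions. *)
definition weak_conv_filter ::
  "('a \<Rightarrow> real measure) \<Rightarrow> real measure \<Rightarrow> 'a filter \<Rightarrow> bool" where
  "weak_conv_filter M N F \<longleftrightarrow>
     (\<forall>f :: real \<Rightarrow> real. continuous_on UNIV f \<and> bounded (range f) \<longrightarrow>
        ((\<lambda>t. LINT x|M t. f x) \<longlongrightarrow> (LINT x|N. f x)) F)"

(* The family is a function on all of real, but only its values at times t >= 0 matter. *)
definition DR_model :: "real measure \<Rightarrow> (real \<Rightarrow> real measure) \<Rightarrow> bool" where
  "DR_model \<mu>0 \<mu> \<longleftrightarrow>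
     real_distribution \<mu>0 \<and> (AE x in \<mu>0. 0 \<le> x) \<and>
     (\<forall>t\<ge>0. real_distribution (\<mu> t)) \<and>
     (\<forall>t\<ge>0. weak_conv_filter \<mu> (\<mu> t) (at t within {0..})) \<and>
     \<mu> 0 = \<mu>0 \<and>
     (\<forall>f f' :: real \<Rightarrow> real.
        (\<forall>x. (f has_real_derivative f' x) (at x)) \<and> continuous_on UNIV f' \<and>
        bounded (range f) \<and> bounded (range f') \<longrightarrow>
        (\<forall>t>0. (LINT x|\<mu> t. f x) - (LINT x|\<mu>0. f x) =
           (LINT s:{0..t}|lborel.
              - (LINT x|\<mu> s. f' x * indicator {0<..} x + f x)
              + (LINT z|(\<mu> s \<Otimes>\<^sub>M \<mu> s). f (fst z + snd z)))))"

(* exponential_density takes the value lam at x = 0 rather than 0; this does not change the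
   measure. *)
definition exp_mixture :: "real \<Rightarrow> real \<Rightarrow> real measure" where
  "exp_mixture p lam =
     measure_of UNIV (sets borel)
       (\<lambda>A. ennreal p * emeasure (return borel 0) A
            + ennreal (1 - p) * emeasure (density lborel (exponential_density lam)) A)"

(* measure_of silently yields the null measure unless the given set function is a measure;
   the next two lemmas show that this does not happen here. *)
lemma emeasure_exp_mixture:
  assumes "A \<in> sets borel"
  shows "emeasure (exp_mixture p lam) A =
     ennreal p * indicator A 0
     + ennreal (1 - p) * emeasure (density lborel (exponential_density lam)) A"
proof -
  let ?D = "density lborel (exponential_density lam)"
  let ?m = "\<lambda>A. ennreal p * emeasure (return borel 0) A + ennreal (1 - p) * emeasure ?D A"
  have "emeasure (exp_mixture p lam) A = ?m A"
    unfolding exp_mixture_def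
  proof (rule emeasure_measure_of_sigma)
    show "sigma_algebra UNIV (sets (borel :: real measure))"
      using sets.sigma_algebra_axioms[of "borel :: real measure"] by simp
    show "positive (sets borel) ?m" by (simp add: positive_def)
    show "countably_additive (sets borel) ?m"
    proof (rule countably_additiveI)
      fix B :: "nat \<Rightarrow> real set"
      assume B: "range B \<subseteq> sets borel" "disjoint_family B"
      have 1: "(\<Sum>i. emeasure (return borel 0) (B i)) = emeasure (return borel 0) (\<Union>i. B i)"
        using B by (intro suminf_emeasure) auto
      have 2: "(\<Sum>i. emeasure ?D (B i)) = emeasure ?D (\<Union>i. B i)"
        using B by (intro suminf_emeasure) auto
      show "(\<Sum>i. ?m (B i)) = ?m (\<Union>i. B i)"
        by (simp only: 1[symmetric] 2[symmetric] suminf_add[symmetric, OF summableI summableI]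
              ennreal_suminf_cmult)
    qed
  qed (use assms in auto)
  then show ?thesis using assms by simp
qed

lemma real_distribution_exp_mixture:
  assumes "0 \<le> p" "p < 1" "0 < lam"
  shows "real_distribution (exp_mixture p lam)"
proof (intro real_distribution.intro real_distribution_axioms.intro prob_spaceI)
  have sp: "space (exp_mixture p lam) = UNIV"
    by (simp add: exp_mixture_def space_measure_of_conv)
  have D: "emeasure (density lborel (exponential_density lam)) UNIV = 1"
    using prob_space.emeasure_space_1[OF prob_space_exponential_density[OF assms(3)]] by simp
  show "emeasure (exp_mixture p lam) (space (exp_mixture p lam)) = 1"
    using assms unfolding sp
    by (simp add: emeasure_exp_mixture D flip: ennreal_plus)
  show "sets (exp_mixture p lam) = sets borel"
    unfolding exp_mixture_def
    by (metis sets.sigma_sets_eq sets_measure_of space_borel sets.space_closed)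
qed

definition DR_mean :: "(real \<Rightarrow> real measure) \<Rightarrow> real \<Rightarrow> real" where
  "DR_mean \<mu> t = (LINT x:{0..}|\<mu> t. x)"

definition DR_F_infty :: "(real \<Rightarrow> real measure) \<Rightarrow> real" where
  "DR_F_infty \<mu> = Lim at_top (\<lambda>t. exp (- t) * DR_mean \<mu> t)"

definition DR_P :: "(real \<times> real) set" where
  "DR_P = {(p, lam). 0 \<le> p \<and> p < 1 \<and> 0 \<le> lam \<and>
             (lam < 1 \<or> (1 \<le> lam \<and> p < lam - lam * ln lam))}"

definition DR_C :: "(real \<times> real) set" where
  "DR_C = {(p, lam). 0 \<le> p \<and> p < 1 \<and> 1 \<le> lam \<and> p = lam - lam * ln lam}"

definition DR_U :: "(real \<times> real) set" where
  "DR_U = {(p, lam). 0 \<le> p \<and> p < 1 \<and> 1 \<le> lam \<and> p > lam - lam * ln lam}"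

end

theory Submission
  imports Defs "HOL-Real_Asymp.Real_Asymp"
begin

text \<open>
  Mixtures of \<open>\<delta>\<^sub>0\<close> and an exponential law are preserved by the dynamics: \<open>\<mu>\<^sub>t\<close> has parameters
  \<open>p\<close>, \<open>L\<close> solving \<open>p' = (1 - p) (L - p)\<close> and \<open>L' = - (1 - p) L\<close>. The quantity
  \<open>H = p / L + ln L\<close> is conserved, which leaves the autonomous equation
  \<open>L' = - L (1 - L (H - ln L))\<close>; \<open>L\<close> decreases to the largest zero \<open>z\<close> of the right-hand side
  below the initial value: \<open>z = 0\<close> on P, the root \<open>x > 1\<close> on U, and the double root \<open>1\<close> on C.
  The mean \<open>(1 - p) / L\<close> has logarithmic derivative \<open>1 - L\<close>, and all asymptotics follow from the
  speed at which \<open>L\<close> tends to \<open>z\<close>.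

  To identify an arbitrary weak solution with this one, integrate the weak equation along
  characteristics, tested against smooth approximations of half-line indicators. This gives a
  Duhamel formula for the distribution functions in which only the convolution and absorption terms
  remain, and these are Lipschitz in the Kolmogorov distance, so iterating bounds the distance of
  two solutions at time \<open>t\<close> by \<open>(3 t)\<^sup>n / n!\<close> for every \<open>n\<close>.
\<close>

section \<open>Convolutions and uniqueness of mild solutions\<close>

lemma real_distribution_finite_measure: "real_distribution M \<Longrightarrow> finite_measure M"
  by (simp add: real_distribution_def prob_space_def)

lemma real_distribution_convolution:
  assumes "real_distribution M" "real_distribution N"
  shows "real_distribution (M \<star> N)"
proof -
  interpret M: real_distribution M by fact
  interpret N: real_distribution N by fact
  interpret pair_prob_space M N ..
  have "prob_space (M \<star> N)"
    unfolding convolution_def by (rule prob_space_distr) simp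
  then show ?thesis
    by (simp add: real_distribution_def real_distribution_axioms_def)
qed

text \<open>The weak equation integrates over the product measure; this passes to
  \<open>M \<star> N\<close>, so that the reaction term becomes an integral against a single
  law.\<close>

lemma integral_convolution:
  fixes f :: "real \<Rightarrow> 'a::{banach, second_countable_topology}"
  assumes "real_distribution M" "real_distribution N" "f \<in> borel_measurable borel"
  shows "(LINT z|(M \<Otimes>\<^sub>M N). f (fst z + snd z)) = (LINT x|(M \<star> N). f x)"
proof -
  interpret M: real_distribution M by fact
  interpret N: real_distribution N by fact
  show ?thesis
    unfolding convolution_def using assms(3)
    by (subst integral_distr) (auto simp: split_beta)
qed

lemma integral_convolution_iterated:
  fixes f :: "real \<Rightarrow> 'a::{banach, second_countable_topology}"
  assumes M: "real_distribution M" and N: "real_distribution N"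
    and f: "f \<in> borel_measurable borel" and B: "\<And>x. norm (f x) \<le> B"
  shows "(LINT x|(M \<star> N). f x) = (LINT x|M. LINT y|N. f (x + y))"
proof -
  interpret M: real_distribution M by fact
  interpret N: real_distribution N by fact
  interpret pair_prob_space M N ..
  note f[measurable]
  have "integrable (M \<Otimes>\<^sub>M N) (\<lambda>z. f (fst z + snd z))"
    by (rule P.integrable_const_bound[where B=B]) (auto simp: B)
  then have "(LINT x|M. LINT y|N. f (fst (x, y) + snd (x, y))) = (LINT z|(M \<Otimes>\<^sub>M N). f (fst z + snd z))"
    by (intro integral_fst') simp
  then show ?thesis
    by (simp add: integral_convolution[OF M N f])
qed

lemma char_convolution:
  assumes "real_distribution M" "real_distribution N"
  shows "char (M \<star> N) t = char M t * char N t"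
proof -
  have "char (M \<star> N) t = (CLINT x|M. CLINT y|N. iexp (t * (x + y)))"
    unfolding char_def using assms by (intro integral_convolution_iterated[where B=1]) auto
  also have "\<dots> = (CLINT x|M. CLINT y|N. iexp (t * x) * iexp (t * y))"
    by (simp add: distrib_left exp_add)
  finally show ?thesis
    by (simp add: char_def)
qed

lemma cdf_convolution:
  assumes M: "real_distribution M" and N: "real_distribution N"
  shows "cdf (M \<star> N) c = (LINT x|M. cdf N (c - x))"
proof -
  interpret M: real_distribution M by fact
  interpret N: real_distribution N by fact
  interpret C: real_distribution "M \<star> N"
    by (rule real_distribution_convolution[OF M N])
  have "cdf (M \<star> N) c = (LINT x|(M \<star> N). indicator {..c} x)"
    by (simp add: cdf_def)
  also have "\<dots> = (LINT x|M. LINT y|N. indicator {..c} (x + y))"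
    by (rule integral_convolution_iterated[OF M N, where B=1]) (auto simp: indicator_def)
  also have "\<dots> = (LINT x|M. LINT y|N. indicator {..c - x} y)"
    by (intro Bochner_Integration.integral_cong refl) (auto simp: indicator_def)
  finally show ?thesis by (simp add: cdf_def)
qed

lemma (in real_distribution) cdf_measurable [measurable]: "cdf M \<in> borel_measurable borel"
  by (rule borel_measurable_mono) (auto simp: mono_def cdf_nondecreasing)

text \<open>By \<open>cdf_convolution\<close> both values are averages over \<open>L\<close>, of
  \<open>cdf M\<close> and \<open>cdf N\<close> at the same shifted points, so the uniform distance
  does not grow.\<close>

lemma cdf_convolution_diff_le:
  assumes L: "real_distribution L" and M: "real_distribution M" and N: "real_distribution N"
    and e: "\<And>a. \<bar>cdf M a - cdf N a\<bar> \<le> e"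
  shows "\<bar>cdf (L \<star> M) c - cdf (L \<star> N) c\<bar> \<le> e"
proof -
  interpret L: real_distribution L by fact
  interpret M: real_distribution M by fact
  interpret N: real_distribution N by fact
  have int: "integrable L (\<lambda>x. cdf K (c - x))" if "real_distribution K" for K
  proof -
    interpret K: real_distribution K by fact
    show ?thesis
      by (rule L.integrable_const_bound[where B=1]) (auto simp: K.cdf_nonneg K.cdf_bounded_prob)
  qed
  have "cdf (L \<star> M) c - cdf (L \<star> N) c = (LINT x|L. cdf M (c - x) - cdf N (c - x))"
    by (simp add: cdf_convolution L M N int)
  also have "\<bar>\<dots>\<bar> \<le> (LINT x|L. \<bar>cdf M (c - x) - cdf N (c - x)\<bar>)"
    by (rule integral_abs_bound)
  also have "\<dots> \<le> (LINT x|L. e)"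
    by (intro integral_mono Bochner_Integration.integrable_diff integrable_abs int M N e) simp
  finally show ?thesis using L.prob_space by simp
qed

text \<open>One factor is exchanged at a time, from \<open>M \<star> M\<close> over
  \<open>N \<star> M\<close> to \<open>N \<star> N\<close>, and each exchange costs
  \<open>e\<close>.\<close>

lemma cdf_convolution_self_diff_le:
  assumes M: "real_distribution M" and N: "real_distribution N"
    and e: "\<And>a. \<bar>cdf M a - cdf N a\<bar> \<le> e"
  shows "\<bar>cdf (M \<star> M) c - cdf (N \<star> N) c\<bar> \<le> 2 * e"
proof -
  have "(M \<star> N) = (N \<star> M)"
    using M N by (intro convolution_commutative)
      (auto simp: real_distribution_finite_measure real_distribution.events_eq_borel)
  then show ?thesis
    using cdf_convolution_diff_le[OF M M N e, of c] cdf_convolution_diff_le[OF N M N e, of c]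
    by simp
qed

text \<open>The Duhamel formula for the distribution functions; \<open>sg\<close> is the speed of the characteristics:
  mass to the right of 0 moves left at speed 1, mass in \<open>(-\<infinity>, 0]\<close> stays where it is.\<close>

definition mild_DR :: "(real \<Rightarrow> real measure) \<Rightarrow> bool" where
  "mild_DR M \<longleftrightarrow> (\<forall>t\<ge>0. real_distribution (M t)) \<and>
     (\<forall>t a sg. 0 \<le> t \<longrightarrow> sg = (if 0 \<le> a then 1 else 0) \<longrightarrow>
        set_integrable lborel {0..t}
          (\<lambda>s. cdf (M s \<star> M s) (a + sg * (t - s)) - cdf (M s) (a + sg * (t - s))) \<and>
        cdf (M t) a - cdf (M 0) (a + sg * t) =
          (LINT s:{0..t}|lborel.
             cdf (M s \<star> M s) (a + sg * (t - s)) - cdf (M s) (a + sg * (t - s))))"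

lemma set_lebesgue_integral_power_Icc:
  assumes "(0::real) \<le> t"
  shows "set_integrable lborel {0..t} (\<lambda>s. s ^ n)"
    and "(LINT s:{0..t}|lborel. s ^ n) = t ^ Suc n / Suc n"
proof -
  show i: "set_integrable lborel {0..t} (\<lambda>s. s ^ n)"
    by (intro borel_integrable_atLeastAtMost') (auto intro!: continuous_intros)
  have "((\<lambda>s. s ^ n) has_integral (t ^ Suc n / Suc n - 0 ^ Suc n / Suc n)) {0..t}"
    using assms
    by (intro fundamental_theorem_of_calculus)
      (auto intro!: derivative_eq_intros simp: has_real_derivative_iff_has_vector_derivative[symmetric]
        simp del: of_nat_Suc power_Suc)
  then show "(LINT s:{0..t}|lborel. s ^ n) = t ^ Suc n / Suc n"
    using set_borel_integral_eq_integral(2)[OF i] by (simp add: integral_unique)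
qed

theorem mild_DR_unique:
  assumes M: "mild_DR M" and N: "mild_DR N" and "M 0 = N 0" and "0 \<le> t"
  shows "M t = N t"
proof -
  have rM: "real_distribution (M s)" and rN: "real_distribution (N s)" if "0 \<le> s" for s
    using M N that by (auto simp: mild_DR_def)
  have bound: "\<bar>cdf (M s) a - cdf (N s) a\<bar> \<le> (3 * s) ^ n / fact n" if "0 \<le> s" for n s a
    using that
  proof (induction n arbitrary: s a)
    case 0
    have "cdf K a \<le> 1" "0 \<le> cdf K a" if "real_distribution K" for K
      using real_distribution.cdf_bounded_prob[OF that] finite_borel_measure.cdf_nonneg
        real_distribution.finite_borel_measure_M[OF that] by auto
    from this[OF rM[OF 0]] this[OF rN[OF 0]] show ?case
      by (simp add: abs_le_iff)
  next
    case (Suc n)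
    define sg :: real where "sg = (if 0 \<le> a then 1 else 0)"
    define v where "v K r = cdf (K r \<star> K r) (a + sg * (s - r)) - cdf (K r) (a + sg * (s - r))"
      for K :: "real \<Rightarrow> real measure" and r
    \<comment> \<open>The factor 3 is 2 for the convolution square plus 1 for the absorption term;
      it multiplies the induction bound at time \<open>r\<close>.\<close>
    define B where "B r = 3 * (3 ^ n / fact n) * r ^ n" for r :: real
    have iM: "set_integrable lborel {0..s} (v M)"
      and eM: "cdf (M s) a - cdf (M 0) (a + sg * s) = (LINT r:{0..s}|lborel. v M r)"
      using M Suc.prems sg_def unfolding mild_DR_def v_def by blast+
    have iN: "set_integrable lborel {0..s} (v N)"
      and eN: "cdf (N s) a - cdf (N 0) (a + sg * s) = (LINT r:{0..s}|lborel. v N r)"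
      using N Suc.prems sg_def unfolding mild_DR_def v_def by blast+
    have iB: "set_integrable lborel {0..s} B"
      unfolding B_def using set_lebesgue_integral_power_Icc(1)[OF Suc.prems] by simp
    have le: "\<bar>v M r - v N r\<bar> \<le> B r" if r: "0 \<le> r" for r
    proof -
      have "\<bar>cdf (M r \<star> M r) c - cdf (N r \<star> N r) c\<bar> \<le> 2 * ((3 * r) ^ n / fact n)" for c
        using cdf_convolution_self_diff_le[OF rM[OF r] rN[OF r] Suc.IH[OF r]] .
      from this[of "a + sg * (s - r)"] Suc.IH[OF r, of "a + sg * (s - r)"] show ?thesis
        unfolding v_def B_def by (simp add: power_mult_distrib)
    qed
    have "cdf (M s) a - cdf (N s) a = (LINT r:{0..s}|lborel. v M r - v N r)"
      using eM eN \<open>M 0 = N 0\<close> by (simp add: set_integral_diff[OF iM iN])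
    also have "\<bar>\<dots>\<bar> \<le> (LINT r:{0..s}|lborel. \<bar>v M r - v N r\<bar>)"
      using set_integral_norm_bound[OF set_integral_diff(1)[OF iM iN]] by simp
    also have "\<dots> \<le> (LINT r:{0..s}|lborel. B r)"
      by (intro set_integral_mono set_integrable_abs set_integral_diff iM iN iB le) auto
    also have "\<dots> = 3 * (3 ^ n / fact n) * (s ^ Suc n / Suc n)"
      unfolding B_def using set_lebesgue_integral_power_Icc(2)[OF Suc.prems, of n] by simp
    also have "\<dots> = (3 * s) ^ Suc n / fact (Suc n)"
      by (simp add: power_mult_distrib field_simps)
    finally show ?case .
  qed
  have "cdf (M t) a = cdf (N t) a" for a
  proof -
    have "(\<lambda>n. (3 * t) ^ n / fact n) \<longlonglongrightarrow> 0"
      using summable_exp[of "3 * t"] by (intro summable_LIMSEQ_zero) (simp add: divide_inverse mult.commute)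
    then have "\<bar>cdf (M t) a - cdf (N t) a\<bar> \<le> 0"
      by (rule tendsto_lowerbound) (use bound[OF \<open>0 \<le> t\<close>] in auto)
    then show ?thesis by simp
  qed
  then show ?thesis
    using cdf_unique rM rN \<open>0 \<le> t\<close> by blast
qed

section \<open>From weak to mild solutions\<close>

text \<open>Kept apart from the equation so that it can be asserted of \<open>\<mu>\<close> and of
  its convolution squares alike.\<close>

definition weakly_continuous :: "(real \<Rightarrow> real measure) \<Rightarrow> bool" where
  "weakly_continuous N \<longleftrightarrow> (\<forall>t\<ge>0. real_distribution (N t)) \<and>
     (\<forall>f :: real \<Rightarrow> real. continuous_on UNIV f \<and> bounded (range f) \<longrightarrow>
        continuous_on {0..} (\<lambda>t. LINT x|N t. f x))"

lemma DR_model_weakly_continuous: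
  assumes "DR_model \<mu>0 \<mu>"
  shows "weakly_continuous \<mu>"
  using assms unfolding DR_model_def weakly_continuous_def weak_conv_filter_def
  by (auto simp: continuous_on_def)

lemma DR_model_weak_equation:
  assumes "DR_model \<mu>0 \<mu>" "\<And>x. (f has_real_derivative f' x) (at x)" "continuous_on UNIV f'"
    "bounded (range f)" "bounded (range f')" "0 < t"
  shows "(LINT x|\<mu> t. f x) - (LINT x|\<mu> 0. f x) =
           (LINT s:{0..t}|lborel.
              - (LINT x|\<mu> s. f' x * indicator {0<..} x + f x)
              + (LINT z|(\<mu> s \<Otimes>\<^sub>M \<mu> s). f (fst z + snd z)))"
  using assms unfolding DR_model_def by blast

text \<open>Characteristic functions turn convolution squares into pointwise squares, and Levy's theorem
  turns pointwise convergence back into weak convergence, so no tightness argument is needed.\<close>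

lemma weakly_continuous_convolution:
  assumes N: "weakly_continuous N"
  shows "weakly_continuous (\<lambda>t. N t \<star> N t)"
proof -
  have rd: "real_distribution (N t)" if "0 \<le> t" for t
    using N that by (simp add: weakly_continuous_def)
  have rd2: "real_distribution (N t \<star> N t)" if "0 \<le> t" for t
    by (intro real_distribution_convolution rd that)
  have "continuous_on {0..} (\<lambda>t. LINT x|(N t \<star> N t). f x)"
    if f: "continuous_on UNIV f" "bounded (range f)" for f :: "real \<Rightarrow> real"
  proof (rule continuous_on_sequentiallyI)
    fix u :: "nat \<Rightarrow> real" and a
    assume u: "\<forall>n. u n \<in> {0..}" "a \<in> {0..}" "u \<longlonglongrightarrow> a"
    have "weak_conv_m (\<lambda>n. N (u n)) (N a)"
    proof (rule integral_bdd_continuous_conv_imp_weak_conv)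
      fix g :: "real \<Rightarrow> real" assume g: "\<And>x. isCont g x" "\<And>x. \<bar>g x\<bar> \<le> 1"
      have "continuous_on UNIV g" "bounded (range g)"
        using g by (auto intro!: continuous_at_imp_continuous_on boundedI[where B=1])
      then have "continuous_on {0..} (\<lambda>t. LINT x|N t. g x)"
        using N unfolding weakly_continuous_def by blast
      then show "(\<lambda>n. LINT x|N (u n). g x) \<longlonglongrightarrow> (LINT x|N a. g x)"
        using u by (auto simp: continuous_on_sequentially o_def)
    qed (use u rd in auto)
    then have "(\<lambda>n. char (N (u n)) r * char (N (u n)) r) \<longlonglongrightarrow> char (N a) r * char (N a) r" for r
      using u by (intro tendsto_mult levy_continuity1) (auto intro: rd)
    then have "(\<lambda>n. char (N (u n) \<star> N (u n)) r) \<longlonglongrightarrow> char (N a \<star> N a) r" for r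
      using u by (simp add: char_convolution rd)
    then have "weak_conv_m (\<lambda>n. N (u n) \<star> N (u n)) (N a \<star> N a)"
      using u by (intro levy_continuity) (auto intro: rd2)
    moreover obtain B where "\<And>x. norm (f x) \<le> B"
      using f(2) by (auto simp: bounded_iff)
    ultimately show "(\<lambda>n. LINT x|(N (u n) \<star> N (u n)). f x) \<longlonglongrightarrow> (LINT x|(N a \<star> N a). f x)"
      using u f(1) by (intro weak_conv_imp_integral_bdd_continuous_conv)
        (auto intro: rd2 simp: continuous_on_eq_continuous_at)
  qed
  then show ?thesis
    by (auto simp: weakly_continuous_def rd2)
qed

lemma (in real_distribution) integrable_bounded_continuous:
  fixes f :: "real \<Rightarrow> real"
  assumes "continuous_on UNIV f" "bounded (range f)"
  shows "integrable M f"
proof -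
  obtain B where "\<And>x. norm (f x) \<le> B" using assms(2) by (auto simp: bounded_iff)
  then show ?thesis
    using assms(1) by (intro integrable_const_bound[where B=B]) (auto intro!: measurable_finite_borel borel_measurable_continuous_onI)
qed

lemma bounded_range_shift: "bounded (range f) \<Longrightarrow> bounded (range (\<lambda>x::real. f (x - r)))"
  by (auto intro: bounded_subset)

lemma continuous_on_shift:
  fixes f :: "real \<Rightarrow> real"
  shows "continuous_on UNIV f \<Longrightarrow> continuous_on UNIV (\<lambda>x. f (x - r))"
  by (rule continuous_on_compose2[of UNIV f]) (auto intro!: continuous_intros)

text \<open>Measure and integrand both move with \<open>s\<close>. Freezing the shift at
  \<open>c s0\<close> leaves weak continuity, and unfreezing it costs at most
  \<open>B * \<bar>c s - c s0\<bar>\<close>, whatever the law.\<close>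

lemma continuous_on_integral_shift:
  fixes f :: "real \<Rightarrow> real"
  assumes N: "weakly_continuous N" and f: "bounded (range f)"
    and lip: "\<And>x y. \<bar>f x - f y\<bar> \<le> B * \<bar>x - y\<bar>"
    and c: "continuous_on S c" and S: "S \<subseteq> {0..}"
  shows "continuous_on S (\<lambda>s. LINT x|N s. f (x - c s))"
  unfolding continuous_on_def
proof
  fix s0 assume s0: "s0 \<in> S"
  have "lipschitz_on B UNIV f"
    using lip lip[of 1 0] by (intro lipschitz_onI) (auto simp: dist_real_def)
  then have fc: "continuous_on UNIV f" by (rule lipschitz_on_continuous_on)
  have rd: "real_distribution (N s)" if "s \<in> S" for s
    using N S that by (auto simp: weakly_continuous_def)
  let ?F = "\<lambda>s r. LINT x|N s. f (x - c r)"
  have "continuous_on {0..} (\<lambda>s. ?F s s0)"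
    using N continuous_on_shift[OF fc] bounded_range_shift[OF f] unfolding weakly_continuous_def
    by blast
  then have "continuous_on S (\<lambda>s. ?F s s0)"
    using S by (rule continuous_on_subset)
  then have 1: "((\<lambda>s. ?F s s0) \<longlongrightarrow> ?F s0 s0) (at s0 within S)"
    using s0 by (simp add: continuous_on_def)
  have 2: "((\<lambda>s. ?F s s - ?F s s0) \<longlongrightarrow> 0) (at s0 within S)"
  proof (rule Lim_transform_bound)
    show "((\<lambda>s. B * \<bar>c s - c s0\<bar>) \<longlongrightarrow> 0) (at s0 within S)"
      using c s0 by (auto simp: continuous_on_def intro!: tendsto_eq_intros)
    show "\<forall>\<^sub>F s in at s0 within S. norm (?F s s - ?F s s0) \<le> norm (B * \<bar>c s - c s0\<bar>)"
      unfolding eventually_at_filter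
    proof (intro always_eventually allI impI)
      fix s assume s: "s \<in> S"
      interpret real_distribution "N s" by (rule rd[OF s])
      have int: "integrable (N s) (\<lambda>x. f (x - r))" for r
        by (intro integrable_bounded_continuous continuous_on_shift bounded_range_shift fc f)
      have lip': "\<bar>f (x - c s) - f (x - c s0)\<bar> \<le> B * \<bar>c s - c s0\<bar>" for x
        using lip[of "x - c s" "x - c s0"] by (simp add: abs_minus_commute)
      have "?F s s - ?F s s0 = (LINT x|N s. f (x - c s) - f (x - c s0))"
        by (simp add: int)
      also have "\<bar>\<dots>\<bar> \<le> (LINT x|N s. \<bar>f (x - c s) - f (x - c s0)\<bar>)"
        by (rule integral_abs_bound)
      also have "\<dots> \<le> (LINT x|N s. B * \<bar>c s - c s0\<bar>)"
        by (intro integral_mono integrable_abs Bochner_Integration.integrable_diff int)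
          (simp_all add: lip')
      finally show "norm (?F s s - ?F s s0) \<le> norm (B * \<bar>c s - c s0\<bar>)"
        using prob_space by simp
    qed
  qed
  show "((\<lambda>s. ?F s s) \<longlongrightarrow> ?F s0 s0) (at s0 within S)"
    using tendsto_add[OF 2 1] by simp
qed

text \<open>Integrating along a characteristic: the transport terms of the two partial derivatives
  of \<open>\<integral> f (x - sg * r) \<mu>\<^sub>s (dx)\<close> in \<open>s\<close> and \<open>r\<close> cancel.\<close>

lemma DR_model_mild_test:
  fixes f f' :: "real \<Rightarrow> real"
  assumes DR: "DR_model \<mu>0 \<mu>" and t: "0 \<le> t"
    and f: "\<And>x. (f has_real_derivative f' x) (at x)" "bounded (range f)"
    and f': "\<And>x. \<bar>f' x\<bar> \<le> B" "\<And>x y. \<bar>f' x - f' y\<bar> \<le> C * \<bar>x - y\<bar>"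
    and sg: "sg \<in> {0, 1}"
    and transport: "\<And>r x. 0 \<le> r \<Longrightarrow> f' (x - sg * r) * indicator {0<..} x = sg * f' (x - sg * r)"
  shows "continuous_on {0..t} (\<lambda>s. (LINT x|(\<mu> s \<star> \<mu> s). f (x - sg * (t - s))) - (LINT x|\<mu> s. f (x - sg * (t - s))))"
    and "(LINT x|\<mu> t. f x) - (LINT x|\<mu> 0. f (x - sg * t)) =
      (LINT s:{0..t}|lborel. (LINT x|(\<mu> s \<star> \<mu> s). f (x - sg * (t - s))) - (LINT x|\<mu> s. f (x - sg * (t - s))))"
proof -
  note W = DR_model_weakly_continuous[OF DR]
  note W2 = weakly_continuous_convolution[OF W]
  have rd: "real_distribution (\<mu> s)" if "0 \<le> s" for s
    using W that by (simp add: weakly_continuous_def)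
  have f'_bdd: "bounded (range f')"
    using f'(1) by (intro boundedI[where B=B]) auto
  have C: "0 \<le> C"
    using f'(2)[of 1 0] by simp
  have fc: "continuous_on UNIV f"
    using f(1) by (auto intro!: DERIV_continuous_on)
  have lip: "\<bar>f x - f y\<bar> \<le> B * \<bar>x - y\<bar>" for x y
  proof -
    have "norm (f x - f y) \<le> B * norm (x - y)"
      by (rule field_differentiable_bound[where S=UNIV and f'=f'])
        (use f f' in auto)
    then show ?thesis by simp
  qed
  have f'c: "continuous_on UNIV f'"
  proof -
    have "lipschitz_on C UNIV f'"
      using f'(2) C by (intro lipschitz_onI) (auto simp: dist_real_def)
    then show ?thesis by (rule lipschitz_on_continuous_on)
  qed
  \<comment> \<open>The mean value inequality is applied to
    \<open>\<lambda>z. f z - f' x * z\<close>, whose derivative on the segment is at most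
    \<open>C * \<bar>y - x\<bar>\<close> in absolute value.\<close>
  have taylor: "\<bar>f y - f x - (y - x) * f' x\<bar> \<le> C * (y - x)\<^sup>2" for x y
  proof -
    have "norm ((f y - f' x * y) - (f x - f' x * x)) \<le> (C * \<bar>y - x\<bar>) * norm (y - x)"
    proof (rule field_differentiable_bound[where S="closed_segment x y" and f'="\<lambda>z. f' z - f' x"])
      fix z assume z: "z \<in> closed_segment x y"
      show "((\<lambda>z. f z - f' x * z) has_field_derivative f' z - f' x) (at z within closed_segment x y)"
        by (auto intro!: derivative_eq_intros has_field_derivative_at_within[OF f(1)])
      have "\<bar>z - x\<bar> \<le> \<bar>y - x\<bar>"
        using z by (auto simp: closed_segment_eq_real_ivl split: if_splits)
      then show "norm (f' z - f' x) \<le> C * \<bar>y - x\<bar>"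
        using order_trans[OF f'(2)[of z x] mult_left_mono[OF _ C]] by simp
    qed auto
    then show ?thesis
      by (simp add: power2_eq_square algebra_simps abs_mult)
  qed
  \<comment> \<open>With \<open>r\<close> the time left to travel, \<open>u\<close> has
    \<open>s\<close>-derivative \<open>v - sg * D\<close> (see \<open>du\<close>) and
    \<open>r\<close>-derivative \<open>- sg * D\<close> (see \<open>ur\<close>).\<close>
  define u where "u s r = (LINT x|\<mu> s. f (x - sg * r))" for s r
  define D where "D s r = (LINT x|\<mu> s. f' (x - sg * r))" for s r
  define v where "v s r = (LINT x|(\<mu> s \<star> \<mu> s). f (x - sg * r)) - u s r" for s r
  have int_f: "integrable (\<mu> s) (\<lambda>x. f (x - r))" and int_f': "integrable (\<mu> s) (\<lambda>x. f' (x - r))"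
    if "0 \<le> s" for s r
    using real_distribution.integrable_bounded_continuous[OF rd[OF that]]
      continuous_on_shift bounded_range_shift fc f'c f'_bdd f(2) by blast+
  have cont_v: "continuous_on {0..t'} (\<lambda>s. v s (k s))"
    and cont_D: "continuous_on {0..t'} (\<lambda>s. D s (k s))"
    if "continuous_on {0..t'} k" for t' k
    unfolding u_def v_def D_def
    using that by (auto intro!: continuous_intros continuous_on_integral_shift[OF W f(2) lip]
      continuous_on_integral_shift[OF W2 f(2) lip] continuous_on_integral_shift[OF W f'_bdd f'(2)])
  \<comment> \<open>The weak equation for the shifted test function: \<open>transport\<close> trades
    the indicator for the factor \<open>sg\<close>, and continuity in \<open>s\<close> allows the
    gauge integral, which can then be differentiated.\<close>
  have weak: "u \<tau> r - u 0 r = integral {0..\<tau>} (\<lambda>s. v s r - sg * D s r)" if "0 \<le> \<tau>" "0 \<le> r" for \<tau> r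
  proof (cases "\<tau> = 0")
    case False
    with that have \<tau>: "0 < \<tau>" by simp
    have "((\<lambda>x. f (x - sg * r)) has_real_derivative f' (x - sg * r)) (at x)" for x
      using DERIV_shift[of f "f' (x - sg * r)" x "- (sg * r)"] f(1) by simp
    then have "u \<tau> r - u 0 r = (LINT s:{0..\<tau>}|lborel.
              - (LINT x|\<mu> s. f' (x - sg * r) * indicator {0<..} x + f (x - sg * r))
              + (LINT z|(\<mu> s \<Otimes>\<^sub>M \<mu> s). f (fst z + snd z - sg * r)))"
      unfolding u_def
      by (intro DR_model_weak_equation[OF DR] continuous_on_shift f'c bounded_range_shift f'_bdd f(2) \<tau>)
    also have "\<dots> = (LINT s:{0..\<tau>}|lborel. v s r - sg * D s r)"
    proof (intro set_lebesgue_integral_cong allI impI)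
      fix s assume "s \<in> {0..\<tau>}"
      then have s: "0 \<le> s" by simp
      have "(LINT x|\<mu> s. f' (x - sg * r) * indicator {0<..} x + f (x - sg * r)) = sg * D s r + u s r"
        by (simp add: transport that D_def u_def int_f int_f' s)
      moreover have "(\<lambda>x. f (x - sg * r)) \<in> borel_measurable borel"
        by (intro borel_measurable_continuous_onI continuous_on_shift fc)
      ultimately show "- (LINT x|\<mu> s. f' (x - sg * r) * indicator {0<..} x + f (x - sg * r))
              + (LINT z|(\<mu> s \<Otimes>\<^sub>M \<mu> s). f (fst z + snd z - sg * r)) = v s r - sg * D s r"
        using integral_convolution[OF rd[OF s] rd[OF s]] by (simp add: v_def)
    qed simp
    also have "\<dots> = integral {0..\<tau>} (\<lambda>s. v s r - sg * D s r)"
      by (intro set_borel_integral_eq_integral borel_integrable_atLeastAtMost' continuous_intros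
          cont_v cont_D)
    finally show ?thesis .
  qed simp
  have du: "((\<lambda>s. u s r) has_real_derivative v s r - sg * D s r) (at s within {0..t})"
    if "0 \<le> r" "s \<in> {0..t}" for r s
  proof -
    have "((\<lambda>s. u 0 r + integral {0..s} (\<lambda>s. v s r - sg * D s r)) has_real_derivative
        0 + (v s r - sg * D s r)) (at s within {0..t})"
      by (intro DERIV_add DERIV_const integral_has_real_derivative continuous_intros cont_v cont_D that)
    moreover have "u 0 r + integral {0..y} (\<lambda>s. v s r - sg * D s r) = u y r" if "y \<in> {0..t}" for y
      using weak[of y r] that \<open>0 \<le> r\<close> by simp
    ultimately have "((\<lambda>s. u s r) has_real_derivative 0 + (v s r - sg * D s r)) (at s within {0..t})"
      by (rule has_field_derivative_transform_within[OF _ zero_less_one \<open>s \<in> {0..t}\<close>])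
    then show ?thesis by simp
  qed
  \<comment> \<open>The remainder bound is uniform in \<open>s\<close>, because both arguments of
    \<open>u\<close> will move at once.\<close>
  have ur: "\<bar>u s r' - u s r + sg * (r' - r) * D s r\<bar> \<le> C * (r' - r)\<^sup>2" if "0 \<le> s" for s r r'
  proof -
    interpret real_distribution "\<mu> s" by (rule rd[OF that])
    have "u s r' - u s r + sg * (r' - r) * D s r =
        (LINT x|\<mu> s. f (x - sg * r') - f (x - sg * r) + sg * (r' - r) * f' (x - sg * r))"
      unfolding u_def D_def by (simp add: int_f int_f' that)
    then have "\<bar>u s r' - u s r + sg * (r' - r) * D s r\<bar> \<le>
        (LINT x|\<mu> s. \<bar>f (x - sg * r') - f (x - sg * r) + sg * (r' - r) * f' (x - sg * r)\<bar>)"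
      by (simp only: integral_abs_bound)
    also have "\<dots> \<le> (LINT x|\<mu> s. C * (r' - r)\<^sup>2)"
    proof (intro integral_mono integrable_abs Bochner_Integration.integrable_diff
        Bochner_Integration.integrable_add int_f int_f' integrable_mult_right that)
      fix x
      have "\<bar>f (x - sg * r') - f (x - sg * r) + sg * (r' - r) * f' (x - sg * r)\<bar> \<le> C * (sg * (r' - r))\<^sup>2"
        using taylor[of "x - sg * r'" "x - sg * r"] by (simp add: algebra_simps power2_commute)
      also have "\<dots> \<le> C * (r' - r)\<^sup>2"
        using sg C by auto
      finally show "\<bar>f (x - sg * r') - f (x - sg * r) + sg * (r' - r) * f' (x - sg * r)\<bar> \<le> C * (r' - r)\<^sup>2" .
    qed simp
    finally show ?thesis using prob_space by simp
  qed
  have dw: "((\<lambda>s. u s (t - s)) has_real_derivative v s (t - s)) (at s within {0..t})" if s: "s \<in> {0..t}" for s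
  proof -
    define r where "r = t - s"
    have r: "0 \<le> r" using s by (simp add: r_def)
    \<comment> \<open>Freezing \<open>r\<close> splits \<open>u y (t - y)\<close> into
      \<open>u y r\<close>, handled by \<open>du\<close>, and this remainder. Its difference
      quotient is within \<open>C * \<bar>y - s\<bar>\<close> of \<open>sg * D y r\<close> by
      \<open>ur\<close>, and \<open>D y r\<close> tends to \<open>D s r\<close>.\<close>
    have "((\<lambda>y. u y (t - y) - u y r) has_real_derivative sg * D s r) (at s within {0..t})"
      unfolding has_field_derivative_iff
    proof (rule Lim_transform2)
      have "continuous_on {0..t} (\<lambda>y. D y r)" by (intro cont_D continuous_intros)
      then show "((\<lambda>y. sg * D y r) \<longlongrightarrow> sg * D s r) (at s within {0..t})"
        using s by (auto simp: continuous_on_def intro!: tendsto_intros)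
      show "((\<lambda>y. sg * D y r - ((u y (t - y) - u y r) - (u s (t - s) - u s r)) / (y - s)) \<longlongrightarrow> 0) (at s within {0..t})"
      proof (rule Lim_transform_bound)
        show "((\<lambda>y. C * \<bar>y - s\<bar>) \<longlongrightarrow> 0) (at s within {0..t})"
          by (auto intro!: tendsto_eq_intros)
        show "\<forall>\<^sub>F y in at s within {0..t}.
          norm (sg * D y r - ((u y (t - y) - u y r) - (u s (t - s) - u s r)) / (y - s)) \<le> norm (C * \<bar>y - s\<bar>)"
          unfolding eventually_at_filter
        proof (intro always_eventually allI impI)
          fix y assume y: "y \<noteq> s" "y \<in> {0..t}"
          have "sg * D y r - ((u y (t - y) - u y r) - (u s (t - s) - u s r)) / (y - s)
              = - (u y (t - y) - u y r + sg * (t - y - r) * D y r) / (y - s)"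
            using y by (simp add: r_def field_simps)
          also have "\<bar>\<dots>\<bar> \<le> C * (t - y - r)\<^sup>2 / \<bar>y - s\<bar>"
            using ur[of y "t - y" r] y by (auto simp: abs_divide intro!: divide_right_mono)
          also have "\<dots> = C * \<bar>y - s\<bar>"
            using y by (simp add: r_def field_simps power2_eq_square abs_if)
          finally show "norm (sg * D y r - ((u y (t - y) - u y r) - (u s (t - s) - u s r)) / (y - s)) \<le> norm (C * \<bar>y - s\<bar>)"
            using C by simp
        qed
      qed
    qed
    from DERIV_add[OF du[OF r s] this] show ?thesis
      by (simp add: r_def)
  qed
  show cont: "continuous_on {0..t} (\<lambda>s. (LINT x|(\<mu> s \<star> \<mu> s). f (x - sg * (t - s))) - (LINT x|\<mu> s. f (x - sg * (t - s))))"
    using cont_v[of t "\<lambda>s. t - s"] unfolding v_def u_def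
    by (simp add: continuous_on_op_minus)
  have "((\<lambda>s. v s (t - s)) has_integral u t (t - t) - u 0 (t - 0)) {0..t}"
    using t dw by (intro fundamental_theorem_of_calculus)
      (auto simp: has_real_derivative_iff_has_vector_derivative)
  then show "(LINT x|\<mu> t. f x) - (LINT x|\<mu> 0. f (x - sg * t)) =
      (LINT s:{0..t}|lborel. (LINT x|(\<mu> s \<star> \<mu> s). f (x - sg * (t - s))) - (LINT x|\<mu> s. f (x - sg * (t - s))))"
    using set_borel_integral_eq_integral(2)[OF borel_integrable_atLeastAtMost'[OF cont]]
    by (simp add: v_def u_def integral_unique)
qed

section \<open>Smooth approximations of half-line indicators\<close>

definition smooth_step :: "real \<Rightarrow> real" where
  "smooth_step x = 1 - 2 * (max 0 x)\<^sup>2 + 4 * (max 0 (x - 1/2))\<^sup>2 - 2 * (max 0 (x - 1))\<^sup>2"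

text \<open>A downward tent supported on \<open>[0, 1]\<close> with minimum -2 at 1/2 and integral
  -1. Thus \<open>smooth_step\<close> falls from 1 to 0 with a bounded Lipschitz derivative, as
  \<open>DR_model_mild_test\<close> asks.\<close>

definition smooth_step' :: "real \<Rightarrow> real" where
  "smooth_step' x = - 4 * max 0 x + 8 * max 0 (x - 1/2) - 4 * max 0 (x - 1)"

lemma DERIV_max_0_square: "((\<lambda>x::real. (max 0 x)\<^sup>2) has_real_derivative 2 * max 0 x) (at x)"
proof (cases "x = 0")
  case True
  have "((\<lambda>h::real. (max 0 h)\<^sup>2 / h) \<longlongrightarrow> 0) (at 0)"
  proof (rule Lim_transform_bound[where g="\<lambda>h. h"])
    show "\<forall>\<^sub>F h in at 0. norm ((max 0 h)\<^sup>2 / h) \<le> norm (h::real)"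
      by (intro always_eventually) (auto simp: max_def power2_eq_square)
  qed (rule tendsto_ident_at)
  then show ?thesis
    by (simp add: True has_field_derivative_iff)
next
  case False
  have "((\<lambda>x::real. (max 0 x)\<^sup>2) has_real_derivative 2 * max 0 x) (at x)" if "x < 0"
    by (rule has_field_derivative_transform_within_open[where S="{..<0}" and f="\<lambda>_. 0"])
      (use that in auto)
  moreover have "((\<lambda>x::real. (max 0 x)\<^sup>2) has_real_derivative 2 * max 0 x) (at x)" if "x > 0"
    by (rule has_field_derivative_transform_within_open[where S="{0<..}" and f="\<lambda>x. x\<^sup>2"])
      (use that in \<open>auto intro!: derivative_eq_intros\<close>)
  ultimately show ?thesis using False by linarith
qed

lemma DERIV_smooth_step: "(smooth_step has_real_derivative smooth_step' x) (at x)"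
proof -
  have d: "((\<lambda>x::real. (max 0 (x - c))\<^sup>2) has_real_derivative 2 * max 0 (x - c)) (at x)" for c
    using DERIV_shift[of "\<lambda>x. (max 0 x)\<^sup>2" "2 * max 0 (x - c)" x "- c"] DERIV_max_0_square by simp
  have "(smooth_step has_real_derivative
      0 - 2 * (2 * max 0 x) + 4 * (2 * max 0 (x - 1/2)) - 2 * (2 * max 0 (x - 1))) (at x)"
    unfolding smooth_step_def[abs_def]
    by (intro DERIV_diff DERIV_add DERIV_cmult DERIV_const d DERIV_max_0_square)
  then show ?thesis by (simp add: smooth_step'_def)
qed

lemma smooth_step_eq_1: "x \<le> 0 \<Longrightarrow> smooth_step x = 1"
  by (simp add: smooth_step_def)

lemma smooth_step_eq_0: "1 \<le> x \<Longrightarrow> smooth_step x = 0"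
  by (simp add: smooth_step_def power2_eq_square algebra_simps)

lemma smooth_step'_eq_0: "x \<le> 0 \<or> 1 \<le> x \<Longrightarrow> smooth_step' x = 0"
  by (auto simp: smooth_step'_def)

lemma smooth_step'_bounds: "-2 \<le> smooth_step' x" "smooth_step' x \<le> 0"
  by (auto simp: smooth_step'_def max_def)

text \<open>The constant is the crude sum 4 + 8 + 4 of the slopes of the three terms.\<close>

lemma smooth_step'_lipschitz: "\<bar>smooth_step' x - smooth_step' y\<bar> \<le> 16 * \<bar>x - y\<bar>"
  by (auto simp: smooth_step'_def max_def abs_if)

lemma smooth_step_bounds: "0 \<le> smooth_step x" "smooth_step x \<le> 1"
proof -
  have anti: "smooth_step y \<le> smooth_step x" if "x \<le> y" for x y
    by (rule DERIV_nonpos_imp_nonincreasing[OF that]) (use DERIV_smooth_step smooth_step'_bounds(2) in blast)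
  show "0 \<le> smooth_step x"
    using anti[of x "max 1 x"] smooth_step_eq_0[of "max 1 x"] by simp
  show "smooth_step x \<le> 1"
    using anti[of "min 0 x" x] smooth_step_eq_1[of "min 0 x"] by simp
qed

text \<open>The descent lies to the right of \<open>c\<close>, so the steepening steps tend
  pointwise to the indicator of the closed half-line \<open>{..c}\<close>. The limit is therefore
  correct at every \<open>c\<close>, atoms included.\<close>

lemma integral_smooth_step_tendsto_cdf:
  assumes K: "real_distribution K" and k: "filterlim k at_top sequentially"
  shows "(\<lambda>n. LINT x|K. smooth_step (k n * (x - c))) \<longlonglongrightarrow> cdf K c"
proof -
  interpret real_distribution K by fact
  have [measurable]: "smooth_step \<in> borel_measurable borel"
    by (intro borel_measurable_continuous_onI DERIV_continuous_on[OF DERIV_smooth_step[THEN has_field_derivative_at_within]])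
  have "(\<lambda>n. LINT x|K. smooth_step (k n * (x - c))) \<longlonglongrightarrow> (LINT x|K. indicator {..c} x)"
  proof (rule integral_dominated_convergence[where w="\<lambda>_. 1"])
    have "(\<lambda>n. smooth_step (k n * (x - c))) \<longlonglongrightarrow> indicator {..c} x" for x
    proof (cases "x \<le> c")
      case True
      have "eventually (\<lambda>n. 0 \<le> k n) sequentially"
        using k by (simp add: filterlim_at_top)
      then have "eventually (\<lambda>n. smooth_step (k n * (x - c)) = indicator {..c} x) sequentially"
        by eventually_elim (use True in \<open>auto intro!: smooth_step_eq_1 mult_nonneg_nonpos\<close>)
      then show ?thesis by (rule tendsto_eventually)
    next
      case False
      have "eventually (\<lambda>n. 1 / (x - c) \<le> k n) sequentially"
        using k by (simp add: filterlim_at_top)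
      then have "eventually (\<lambda>n. smooth_step (k n * (x - c)) = indicator {..c} x) sequentially"
        by eventually_elim (use False in \<open>auto intro!: smooth_step_eq_0 simp: field_simps\<close>)
      then show ?thesis by (rule tendsto_eventually)
    qed
    then show "AE x in K. (\<lambda>n. smooth_step (k n * (x - c))) \<longlonglongrightarrow> indicator {..c} x" by simp
  qed (use smooth_step_bounds in auto)
  then show ?thesis by (simp add: cdf_def)
qed

text \<open>Steps \<open>f n\<close> with corner at \<open>a\<close> go into
  \<open>DR_model_mild_test\<close>; dominated convergence is then used twice, in space for fixed
  time and in time.\<close>

theorem DR_model_mild:
  assumes DR: "DR_model \<mu>0 \<mu>"
  shows "mild_DR \<mu>"
proof -
  have rd: "real_distribution (\<mu> s)" if "0 \<le> s" for s
    using DR that by (simp add: DR_model_def)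
  have rd2: "real_distribution (\<mu> s \<star> \<mu> s)" if "0 \<le> s" for s
    by (intro real_distribution_convolution rd that)
  have "set_integrable lborel {0..t}
      (\<lambda>s. cdf (\<mu> s \<star> \<mu> s) (a + sg * (t - s)) - cdf (\<mu> s) (a + sg * (t - s))) \<and>
    cdf (\<mu> t) a - cdf (\<mu> 0) (a + sg * t) =
      (LINT s:{0..t}|lborel. cdf (\<mu> s \<star> \<mu> s) (a + sg * (t - s)) - cdf (\<mu> s) (a + sg * (t - s)))"
    if t: "0 \<le> t" and sg: "sg = (if 0 \<le> a then 1 else 0)" for t a sg
  proof -
    \<comment> \<open>for \<open>a < 0\<close> this makes the steps vanish to the right of 0\<close>
    define k where "k n = (if 0 \<le> a then 1 else 1 - 1 / a) + real n" for n
    have k1: "1 \<le> k n" for n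
      using order_trans[of "1 / a" 0 "real n"] by (auto simp: k_def)
    have ka: "1 \<le> k n * - a" if "a < 0" for n
    proof -
      have "k n * - a = 1 + (- a) + real n * (- a)"
        using that by (simp add: k_def field_simps)
      then show ?thesis
        using that mult_nonneg_nonneg[of "real n" "- a"] by linarith
    qed
    have k_top: "filterlim k at_top sequentially"
      unfolding k_def by (intro filterlim_tendsto_add_at_top[OF tendsto_const] filterlim_real_sequentially)
    define f where "f n x = smooth_step (k n * (x - a))" for n x
    define f' where "f' n x = smooth_step' (k n * (x - a)) * k n" for n x
    define c where "c s = a + sg * (t - s)" for s
    define v where "v s = cdf (\<mu> s \<star> \<mu> s) (c s) - cdf (\<mu> s) (c s)" for s
    define V where "V n s = (LINT x|(\<mu> s \<star> \<mu> s). f n (x - sg * (t - s))) - (LINT x|\<mu> s. f n (x - sg * (t - s)))"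
      for n s
    \<comment> \<open>Shifting the argument moves the corner from \<open>a\<close> to
      \<open>a + r\<close>, hence along the characteristic \<open>c\<close>.\<close>
    have f_shift: "f n (x - r) = smooth_step (k n * (x - (a + r)))" for n x r
      by (simp add: f_def algebra_simps)
    have f01: "0 \<le> f n x" "f n x \<le> 1" for n x
      by (auto simp: f_def smooth_step_bounds)
    have test: "continuous_on {0..t} (V n)"
      "(LINT x|\<mu> t. f n x) - (LINT x|\<mu> 0. f n (x - sg * t)) = (LINT s:{0..t}|lborel. V n s)" for n
    proof -
      have 1: "(f n has_real_derivative f' n x) (at x)" for x
        unfolding f_def[abs_def] f'_def
        by (rule DERIV_chain2[OF DERIV_smooth_step]) (auto intro!: derivative_eq_intros)
      have 2: "bounded (range (f n))"
        using f01 by (intro boundedI[where B=1]) auto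
      have 3: "\<bar>f' n x\<bar> \<le> 2 * k n" for x
      proof -
        have "\<bar>smooth_step' (k n * (x - a))\<bar> \<le> 2"
          using smooth_step'_bounds[of "k n * (x - a)"] by simp
        then show ?thesis
          using k1[of n] by (simp add: f'_def abs_mult mult_right_mono)
      qed
      have 4: "\<bar>f' n x - f' n y\<bar> \<le> (16 * (k n)\<^sup>2) * \<bar>x - y\<bar>" for x y
      proof -
        have "\<bar>f' n x - f' n y\<bar> = \<bar>smooth_step' (k n * (x - a)) - smooth_step' (k n * (y - a))\<bar> * k n"
          using k1[of n] by (simp add: f'_def abs_mult left_diff_distrib[symmetric])
        also have "\<dots> \<le> (16 * \<bar>k n * (x - a) - k n * (y - a)\<bar>) * k n"
          using k1[of n] by (intro mult_right_mono smooth_step'_lipschitz) auto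
        also have "k n * (x - a) - k n * (y - a) = k n * (x - y)"
          by (simp add: algebra_simps)
        finally show ?thesis
          using k1[of n] by (simp add: abs_mult power2_eq_square mult_ac)
      qed
      \<comment> \<open>For \<open>0 \<le> a\<close> the shifted descent lies in the positive
        half-line, where mass moves (\<open>sg = 1\<close>); for \<open>a < 0\<close> it lies to the
        left of 0, where mass rests (\<open>sg = 0\<close>).\<close>
      have 5: "f' n (x - sg * r) * indicator {0<..} x = sg * f' n (x - sg * r)" if "0 \<le> r" for r x
      proof (cases "0 \<le> a")
        case True
        then have "k n * (x - r - a) \<le> 0" if "x \<le> 0"
          using k1[of n] that \<open>0 \<le> r\<close> by (intro mult_nonneg_nonpos) auto
        then show ?thesis
          using True by (auto simp: sg f'_def indicator_def smooth_step'_eq_0)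
      next
        case False
        have "1 \<le> k n * (x - a)" if "0 < x"
        proof -
          have "k n * - a \<le> k n * (x - a)"
            using k1[of n] that by (intro mult_left_mono) auto
          then show ?thesis using ka[of n] False by simp
        qed
        then show ?thesis
          using False by (auto simp: sg f'_def indicator_def smooth_step'_eq_0)
      qed
      have 6: "sg \<in> {0, 1}" by (simp add: sg)
      show "continuous_on {0..t} (V n)"
        "(LINT x|\<mu> t. f n x) - (LINT x|\<mu> 0. f n (x - sg * t)) = (LINT s:{0..t}|lborel. V n s)"
        unfolding V_def[abs_def]
        by (rule DR_model_mild_test[OF DR t 1 2 3 4 6 5]; assumption)+
    qed
    have lim_v: "(\<lambda>n. V n s) \<longlonglongrightarrow> v s" if "0 \<le> s" for s
      unfolding V_def v_def c_def f_shift
      by (intro tendsto_diff integral_smooth_step_tendsto_cdf k_top rd rd2 that)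
    have int_f: "0 \<le> (LINT x|K. f n (x - r))" "(LINT x|K. f n (x - r)) \<le> 1" if "real_distribution K" for K n r
    proof -
      interpret real_distribution K by fact
      show "0 \<le> (LINT x|K. f n (x - r))" by (simp add: f01)
      \<comment> \<open>Without integrability the integral is 0 by convention, so the case split
        spares a measurability argument.\<close>
      show "(LINT x|K. f n (x - r)) \<le> 1"
        by (cases "integrable K (\<lambda>x. f n (x - r))")
          (auto simp: not_integrable_integral_eq f01 prob_space intro!: integral_le_const)
    qed
    have V_bound: "\<bar>V n s\<bar> \<le> 1" if "0 \<le> s" for n s
      using int_f[OF rd[OF that], of n "sg * (t - s)"] int_f[OF rd2[OF that], of n "sg * (t - s)"]
      unfolding V_def by linarith
    have mV: "(\<lambda>s. indicator {0..t} s *\<^sub>R V n s) \<in> borel_measurable lborel" for n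
      using borel_integrable_atLeastAtMost'[OF test(1)] by (auto simp: set_integrable_def)
    have lim_ind: "(\<lambda>n. indicator {0..t} s *\<^sub>R V n s) \<longlonglongrightarrow> indicator {0..t} s *\<^sub>R v s" for s
      using lim_v[of s] by (cases "s \<in> {0..t}") auto
    \<comment> \<open>Measurability of \<open>v\<close> in time is inherited from the continuous
      \<open>V n\<close> through the pointwise limit.\<close>
    have mv: "(\<lambda>s. indicator {0..t} s *\<^sub>R v s) \<in> borel_measurable lborel"
      by (rule borel_measurable_LIMSEQ_real[OF lim_ind mV])
    have dom: "integrable lborel (indicator {0..t} :: real \<Rightarrow> real)"
      by (rule integrable_real_indicator) (auto simp: t)
    have bnd: "norm (indicator {0..t} s *\<^sub>R V n s) \<le> indicator {0..t} s" for n s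
      using V_bound[of s n] by (auto simp: indicator_def)
    have "set_integrable lborel {0..t} v"
      unfolding set_integrable_def
      by (rule integrable_dominated_convergence[where s="\<lambda>n s. indicator {0..t} s *\<^sub>R V n s" and w="indicator {0..t}"])
        (intro AE_I2 lim_ind bnd mV mv dom)+
    moreover have "(\<lambda>n. LINT s:{0..t}|lborel. V n s) \<longlonglongrightarrow> (LINT s:{0..t}|lborel. v s)"
      unfolding set_lebesgue_integral_def
      by (rule integral_dominated_convergence[where s="\<lambda>n s. indicator {0..t} s *\<^sub>R V n s" and w="indicator {0..t}"])
        (intro AE_I2 lim_ind bnd mV mv dom)+
    moreover have "(\<lambda>n. (LINT x|\<mu> t. f n x) - (LINT x|\<mu> 0. f n (x - sg * t))) \<longlonglongrightarrow> cdf (\<mu> t) a - cdf (\<mu> 0) (a + sg * t)"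
      unfolding f_shift unfolding f_def
      by (intro tendsto_diff integral_smooth_step_tendsto_cdf k_top rd t order_refl)
    ultimately have "set_integrable lborel {0..t} v"
      "cdf (\<mu> t) a - cdf (\<mu> 0) (a + sg * t) = (LINT s:{0..t}|lborel. v s)"
      unfolding test(2) by (auto intro: LIMSEQ_unique)
    then show ?thesis
      unfolding v_def c_def by simp
  qed
  then show ?thesis
    unfolding mild_DR_def using rd by blast
qed

section \<open>Mixtures of an atom and an exponential law\<close>

lemma sets_exp_mixture [simp, measurable_cong]: "sets (exp_mixture p lam) = sets borel"
  unfolding exp_mixture_def
  by (metis sets.sigma_sets_eq sets_measure_of space_borel sets.space_closed)

lemma space_exp_mixture [simp]: "space (exp_mixture p lam) = UNIV"
  by (simp add: exp_mixture_def space_measure_of_conv)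

text \<open>The mixture is given by its values on sets, so the formula is carried from indicators to
  all nonnegative functions through sums, multiples and monotone limits.\<close>

lemma nn_integral_exp_mixture:
  assumes "f \<in> borel_measurable borel"
  shows "(\<integral>\<^sup>+x. f x \<partial>exp_mixture p lam) =
    ennreal p * f 0 + ennreal (1 - p) * (\<integral>\<^sup>+x. f x \<partial>density lborel (exponential_density lam))"
  using assms
proof (induction rule: borel_measurable_induct)
  case (cong f g)
  then have "f = g" by auto
  with cong show ?case by simp
next
  case (set A)
  then show ?case by (simp add: emeasure_exp_mixture)
next
  case (mult u c)
  then show ?case by (simp add: nn_integral_cmult distrib_left mult_ac)
next
  case (add u v)
  then show ?case by (simp add: nn_integral_add distrib_left add_ac)
next
  case (seq U)
  let ?D = "density lborel (exponential_density lam)"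
  note [measurable] = seq.hyps(1)
  have inc: "incseq (\<lambda>i. U i x)" for x
    using seq.hyps by (auto simp: incseq_def le_fun_def)
  have "(\<integral>\<^sup>+x. (SUP i. U i) x \<partial>exp_mixture p lam) = (SUP i. \<integral>\<^sup>+x. U i x \<partial>exp_mixture p lam)"
    using seq.hyps by (simp add: image_comp nn_integral_monotone_convergence_SUP)
  also have "\<dots> = (SUP i. ennreal p * U i 0 + ennreal (1 - p) * (\<integral>\<^sup>+x. U i x \<partial>?D))"
    using seq.IH by simp
  also have "\<dots> = (SUP i. ennreal p * U i 0) + (SUP i. ennreal (1 - p) * (\<integral>\<^sup>+x. U i x \<partial>?D))"
    using inc seq.hyps
    by (intro ennreal_SUP_add) (auto simp: incseq_def le_fun_def intro!: mult_left_mono nn_integral_mono)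
  also have "\<dots> = ennreal p * (SUP i. U i) 0 + ennreal (1 - p) * (\<integral>\<^sup>+x. (SUP i. U i) x \<partial>?D)"
    using seq.hyps
    by (simp add: SUP_mult_left_ennreal image_comp nn_integral_monotone_convergence_SUP)
  finally show ?case .
qed

text \<open>Both components live on the nonnegative half-line, so \<open>f\<close> is nonnegative
  almost everywhere and \<open>nn_integral_exp_mixture\<close> computes the integral.\<close>

lemma
  fixes f :: "real \<Rightarrow> real"
  assumes p: "0 \<le> p" "p \<le> 1" and f: "f \<in> borel_measurable borel" "\<And>x. 0 \<le> x \<Longrightarrow> 0 \<le> f x"
    and int: "integrable (density lborel (exponential_density lam)) f"
  shows integrable_exp_mixture: "integrable (exp_mixture p lam) f"
    and integral_exp_mixture: "(LINT x|exp_mixture p lam. f x) =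
      p * f 0 + (1 - p) * (LINT x|density lborel (exponential_density lam). f x)"
proof -
  let ?D = "density lborel (exponential_density lam)"
  note f(1)[measurable]
  have D0: "AE x in ?D. 0 \<le> x"
    by (subst AE_density) (auto simp: exponential_density_def)
  have nn: "AE x in ?D. 0 \<le> f x"
    using D0 by eventually_elim (use f in auto)
  have neg: "emeasure (exp_mixture p lam) {x. x < 0} = 0"
  proof -
    have "{x. x < 0} \<in> sets ?D" "\<And>x. x \<in> {x. x < 0} \<longleftrightarrow> \<not> 0 \<le> (x::real)" by auto
    then have "emeasure ?D {x. x < 0} = 0"
      using D0 by (subst AE_iff_measurable[symmetric, where P="\<lambda>x. 0 \<le> x"]) auto
    then show ?thesis by (simp add: emeasure_exp_mixture)
  qed
  have "AE x in exp_mixture p lam. 0 \<le> x"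
    by (rule AE_I[OF _ neg]) auto
  then have nn': "AE x in exp_mixture p lam. 0 \<le> f x"
    by eventually_elim (use f in auto)
  have "0 \<le> (LINT x|?D. f x)"
    by (rule integral_nonneg_AE[OF nn])
  then have *: "(\<integral>\<^sup>+x. ennreal (f x) \<partial>exp_mixture p lam) = ennreal (p * f 0 + (1 - p) * (LINT x|?D. f x))"
    using p f(2)[of 0]
    by (simp add: nn_integral_exp_mixture nn_integral_eq_integral[OF int nn] ennreal_mult)
  have "has_bochner_integral (exp_mixture p lam) f (p * f 0 + (1 - p) * (LINT x|?D. f x))"
    using p f(2)[of 0] \<open>0 \<le> (LINT x|?D. f x)\<close>
    by (intro has_bochner_integral_nn_integral[OF _ nn' _ *]) auto
  then show "integrable (exp_mixture p lam) f"
    "(LINT x|exp_mixture p lam. f x) = p * f 0 + (1 - p) * (LINT x|?D. f x)"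
    by (auto simp: has_bochner_integral_iff)
qed

lemma cdf_exp_mixture:
  assumes "0 \<le> p" "p < 1" "0 < lam"
  shows "cdf (exp_mixture p lam) a = (if 0 \<le> a then 1 - (1 - p) * exp (- lam * a) else 0)"
proof (cases "0 \<le> a")
  case True
  have "0 \<le> 1 - exp (- lam * a)" using assms True by simp
  moreover have "emeasure (exp_mixture p lam) {..a} = ennreal p + ennreal (1 - p) * ennreal (1 - exp (- lam * a))"
    using assms True by (simp add: emeasure_exp_mixture emeasure_erlang_density erlang_CDF_0)
  moreover have "p + (1 - p) * (1 - exp (- lam * a)) = 1 - (1 - p) * exp (- lam * a)"
    by (simp add: algebra_simps)
  ultimately have e: "emeasure (exp_mixture p lam) {..a} = ennreal (1 - (1 - p) * exp (- lam * a))"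
    using assms by (simp flip: ennreal_mult ennreal_plus)
  have "(1 - p) * exp (- lam * a) \<le> 1 * 1"
    using assms True by (intro mult_mono) auto
  then show ?thesis
    using True by (simp add: cdf_def measure_def e)
next
  case False
  then have "emeasure (exp_mixture p lam) {..a} = 0"
    using assms by (simp add: emeasure_exp_mixture emeasure_erlang_density erlang_CDF_0)
  then show ?thesis
    using False by (simp add: cdf_def measure_def)
qed

text \<open>Condition on the first summand. On its exponential part the integrand is
  \<open>lam * exp (- lam * x) - (1 - p) * lam * exp (- lam * c)\<close> over \<open>{0..c}\<close>;
  the second term is constant in \<open>x\<close>, whence the term linear in
  \<open>c\<close>.\<close>

lemma cdf_exp_mixture_convolution:
  assumes p: "0 \<le> p" "p < 1" and lam: "0 < lam"
  shows "cdf (exp_mixture p lam \<star> exp_mixture p lam) c =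
    (if 0 \<le> c then 1 - (1 - p) * (1 + p + (1 - p) * lam * c) * exp (- lam * c) else 0)"
proof -
  let ?N = "exp_mixture p lam" and ?D = "density lborel (exponential_density lam)"
  have rd: "real_distribution ?N"
    by (rule real_distribution_exp_mixture[OF p lam])
  interpret real_distribution ?N by (rule rd)
  interpret D: prob_space ?D by (rule prob_space_exponential_density[OF lam])
  have "integrable ?D (\<lambda>x. cdf ?N (c - x))"
    by (rule D.integrable_const_bound[where B=1]) (auto simp: cdf_nonneg cdf_bounded_prob)
  then have "cdf (?N \<star> ?N) c = p * cdf ?N c + (1 - p) * (LINT x|?D. cdf ?N (c - x))"
    using p by (subst cdf_convolution[OF rd rd], subst integral_exp_mixture) (auto simp: cdf_nonneg)
  also have "(LINT x|?D. cdf ?N (c - x)) = (LINT x|lborel. exponential_density lam x * cdf ?N (c - x))"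
    using lam by (subst integral_density) (auto simp: exponential_density_nonneg)
  also have "\<dots> = (LINT x|lborel. indicator {0..c} x *\<^sub>R (lam * exp (- lam * x) - (1 - p) * lam * exp (- lam * c)))"
    using p lam
    by (intro Bochner_Integration.integral_cong refl)
      (auto simp: cdf_exp_mixture exponential_density_def indicator_def algebra_simps simp flip: exp_add)
  finally have eq: "cdf (?N \<star> ?N) c = p * cdf ?N c + (1 - p) *
    (LINT x|lborel. indicator {0..c} x *\<^sub>R (lam * exp (- lam * x) - (1 - p) * lam * exp (- lam * c)))" .
  show ?thesis
  proof (cases "0 \<le> c")
    case True
    have "(LINT x|lborel. indicator {0..c} x *\<^sub>R (lam * exp (- lam * x) - (1 - p) * lam * exp (- lam * c)))
      = (- exp (- lam * c) - (1 - p) * lam * exp (- lam * c) * c) - (- exp (- lam * 0) - (1 - p) * lam * exp (- lam * c) * 0)"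
      using True
      by (intro integral_FTC_Icc)
        (auto intro!: derivative_eq_intros continuous_intros simp: has_real_derivative_iff_has_vector_derivative[symmetric])
    from eq[unfolded this] have "cdf (?N \<star> ?N) c = p * (1 - (1 - p) * exp (- lam * c)) +
        (1 - p) * (1 - exp (- lam * c) - (1 - p) * lam * exp (- lam * c) * c)"
      using True p lam by (simp add: cdf_exp_mixture)
    then show ?thesis
      using True by (simp add: algebra_simps)
  next
    case False
    then show ?thesis
      using p lam unfolding eq by (simp add: cdf_exp_mixture)
  qed
qed

text \<open>For \<open>0 \<le> a\<close> the two differential equations are exactly what makes
  \<open>1 - (1 - p s) * exp (- L s * (a + (t - s)))\<close> an antiderivative of the reaction term
  along the characteristic. For \<open>a < 0\<close> every distribution function involved
  vanishes.\<close>

lemma mild_DR_exp_mixture: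
  assumes p: "\<And>t. 0 \<le> t \<Longrightarrow> 0 \<le> p t \<and> p t < 1" and L: "\<And>t. 0 \<le> t \<Longrightarrow> 0 < L t"
    and dp: "\<And>t. 0 \<le> t \<Longrightarrow> (p has_real_derivative (1 - p t) * (L t - p t)) (at t)"
    and dL: "\<And>t. 0 \<le> t \<Longrightarrow> (L has_real_derivative - ((1 - p t) * L t)) (at t)"
  shows "mild_DR (\<lambda>t. exp_mixture (p t) (L t))"
proof -
  let ?N = "\<lambda>t. exp_mixture (p t) (L t)"
  have rd: "real_distribution (?N t)" if "0 \<le> t" for t
    using p L that by (intro real_distribution_exp_mixture) auto
  have "set_integrable lborel {0..t} v \<and>
      cdf (?N t) a - cdf (?N 0) (a + sg * t) = (LINT s:{0..t}|lborel. v s)"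
    if t: "0 \<le> t" and sg: "sg = (if 0 \<le> a then 1 else 0)"
      and v: "v = (\<lambda>s. cdf (?N s \<star> ?N s) (a + sg * (t - s)) - cdf (?N s) (a + sg * (t - s)))" for t a sg v
  proof (cases "0 \<le> a")
    case a: True
    define w where "w s = - ((1 - p s) * (p s + (1 - p s) * L s * (a + (t - s))) * exp (- L s * (a + (t - s))))" for s
    have vw: "v s = w s" if "s \<in> {0..t}" for s
      using that p[of s] L[of s] a
      by (simp add: v w_def sg cdf_exp_mixture cdf_exp_mixture_convolution algebra_simps)
    have cont: "continuous_on {0..t} p" "continuous_on {0..t} L"
      by (rule DERIV_continuous_on, rule has_field_derivative_at_within, rule dp dL, simp)+
    have iw: "set_integrable lborel {0..t} w"
      unfolding w_def by (intro borel_integrable_atLeastAtMost' continuous_intros cont)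
    have "((\<lambda>s. 1 - (1 - p s) * exp (- L s * (a + (t - s)))) has_real_derivative w s) (at s within {0..t})"
      if "s \<in> {0..t}" for s
    proof -
      have s: "0 \<le> s" using that by simp
      show ?thesis
        unfolding w_def
        by (rule derivative_eq_intros has_field_derivative_at_within[OF dp[OF s]]
            has_field_derivative_at_within[OF dL[OF s]] refl)+ (simp add: algebra_simps)
    qed
    then have "(w has_integral (1 - (1 - p t) * exp (- L t * (a + (t - t)))) -
        (1 - (1 - p 0) * exp (- L 0 * (a + (t - 0))))) {0..t}"
      using t by (intro fundamental_theorem_of_calculus)
        (auto simp: has_real_derivative_iff_has_vector_derivative)
    then have "cdf (?N t) a - cdf (?N 0) (a + sg * t) = integral {0..t} w"
      using a t p[of t] p[of 0] L[of t] L[of 0] by (simp add: cdf_exp_mixture sg integral_unique)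
    moreover have "set_integrable lborel {0..t} v \<longleftrightarrow> set_integrable lborel {0..t} w"
      by (intro set_integrable_cong refl vw)
    moreover have "(LINT s:{0..t}|lborel. v s) = (LINT s:{0..t}|lborel. w s)"
      by (intro set_lebesgue_integral_cong) (auto simp: vw)
    ultimately show ?thesis
      using iw set_borel_integral_eq_integral(2)[OF iw] by simp
  next
    case a: False
    have "v s = 0" if "s \<in> {0..t}" for s
      using that p[of s] L[of s] a by (simp add: v sg cdf_exp_mixture cdf_exp_mixture_convolution)
    then have "(\<lambda>s. indicator {0..t} s *\<^sub>R v s) = (\<lambda>_. 0)"
      by (auto simp: indicator_def)
    then show ?thesis
      using a t p[of t] p[of 0] L[of t] L[of 0]
      by (simp add: set_integrable_def set_lebesgue_integral_def cdf_exp_mixture sg)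
  qed
  then show ?thesis
    unfolding mild_DR_def using rd by simp
qed

section \<open>The flow of the parameters\<close>

text \<open>The solution is the inverse of the time map \<open>u \<mapsto> \<integral>\<^sub>u\<^sup>a 1 / \<phi>\<close>, which is infinite at \<open>z\<close>
  because \<open>\<phi>\<close> vanishes there at least linearly.\<close>

lemma autonomous_ode_decreasing:
  fixes \<phi> :: "real \<Rightarrow> real"
  assumes cont: "\<And>u. z < u \<Longrightarrow> isCont \<phi> u" and pos: "\<And>u. z < u \<Longrightarrow> 0 < \<phi> u"
    and up: "\<And>u. z < u \<Longrightarrow> u \<le> a \<Longrightarrow> \<phi> u \<le> K * (u - z)" and K: "0 < K" and za: "z < a"
  shows "\<exists>L. L 0 = a \<and>
    (\<forall>t\<ge>0. z < L t \<and> L t \<le> a \<and> (L has_real_derivative - \<phi> (L t)) (at t)) \<and> (L \<longlongrightarrow> z) at_top"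
proof -
  have "\<exists>F. \<forall>x. ereal z < ereal x \<longrightarrow> ereal x < \<infinity> \<longrightarrow> (F has_vector_derivative - 1 / \<phi> x) (at x)"
  proof (rule einterval_antiderivative)
    fix x assume "ereal z < ereal x"
    then have "z < x" by simp
    then show "isCont (\<lambda>x. - 1 / \<phi> x) x"
      using cont[of x] pos[of x] by (intro continuous_intros) auto
  qed simp
  then obtain S0 where S0: "\<And>x. z < x \<Longrightarrow> (S0 has_real_derivative - 1 / \<phi> x) (at x)"
    by (auto simp: has_real_derivative_iff_has_vector_derivative)
  define S where "S x = S0 x - S0 a" for x
  have dS: "(S has_real_derivative - 1 / \<phi> x) (at x)" if "z < x" for x
    using DERIV_diff[OF S0[OF that] DERIV_const[of "S0 a"]] by (simp add: S_def[abs_def])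
  have contS: "isCont S x" if "z < x" for x
    by (rule DERIV_isCont[OF dS[OF that]])
  have S_a: "S a = 0" by (simp add: S_def)
  have S_dec: "S y < S x" if "z < x" "x < y" for x y
  proof (rule DERIV_neg_imp_decreasing[OF \<open>x < y\<close>])
    fix u assume "x \<le> u" "u \<le> y"
    then have "z < u" using that by simp
    then show "\<exists>d. (S has_real_derivative d) (at u) \<and> d < 0"
      using dS[of u] pos[of u] by (intro exI[of _ "- 1 / \<phi> u"]) auto
  qed
  \<comment> \<open>By \<open>up\<close>, \<open>S x + ln (x - z) / K\<close> decreases in
    \<open>x\<close>, so \<open>S\<close> is at least logarithmically large near
    \<open>z\<close>.\<close>
  have S_large: "(ln (a - z) - ln (u - z)) / K \<le> S u" if u: "z < u" "u \<le> a" for u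
  proof -
    have "S a + ln (a - z) / K \<le> S u + ln (u - z) / K"
    proof (rule DERIV_nonpos_imp_nonincreasing[OF \<open>u \<le> a\<close>])
      fix x assume "u \<le> x" "x \<le> a"
      then have x: "z < x" "x \<le> a" using u by auto
      have "((\<lambda>x. S x + ln (x - z) / K) has_real_derivative - 1 / \<phi> x + 1 / (x - z) / K) (at x)"
        using x K by (auto intro!: derivative_eq_intros dS)
      moreover have "1 / (x - z) / K \<le> 1 / \<phi> x"
        using up[OF x] pos[OF x(1)] x K by (simp add: frac_le mult.commute)
      ultimately show "\<exists>d. ((\<lambda>x. S x + ln (x - z) / K) has_real_derivative d) (at x) \<and> d \<le> 0"
        by (intro exI[of _ "- 1 / \<phi> x + 1 / (x - z) / K"]) auto
    qed
    then show ?thesis by (simp add: S_a diff_divide_distrib)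
  qed
  have surj: "\<exists>u. z < u \<and> u \<le> a \<and> S u = t" if t: "0 \<le> t" for t
  proof -
    \<comment> \<open>Chosen so that the lower bound of \<open>S_large\<close> at \<open>v\<close>
      equals \<open>t\<close>.\<close>
    define v where "v = z + (a - z) * exp (- K * t)"
    have "0 < (a - z) * exp (- K * t)" using za by simp
    moreover have "(a - z) * exp (- K * t) \<le> (a - z) * 1"
      using za that K by (intro mult_left_mono) auto
    ultimately have v: "z < v" "v \<le> a" by (auto simp: v_def)
    have "ln (v - z) = ln (a - z) - K * t"
      using za by (simp add: v_def ln_mult)
    then have "t \<le> S v"
      using S_large[OF v] K by simp
    then obtain x where "v \<le> x" "x \<le> a" "S x = t"
      using t v contS IVT2[of S a t v] by (auto simp: S_a)
    then show ?thesis using v by (intro exI[of _ x]) auto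
  qed
  have inj: "inj_on S {z<..}"
  proof (rule inj_onI)
    fix x y assume "x \<in> {z<..}" "y \<in> {z<..}" "S x = S y"
    then show "x = y"
      using S_dec[of x y] S_dec[of y x] by (cases x y rule: linorder_cases) auto
  qed
  \<comment> \<open>Inverting on all of \<open>{z<..}\<close>, beyond \<open>a\<close>, gives a
    two-sided derivative also at time 0.\<close>
  define L where "L = the_inv_into {z<..} S"
  have LS: "L (S u) = u" if "z < u" for u
    unfolding L_def using inj that by (simp add: the_inv_into_f_f)
  have L_range: "z < L t \<and> L t \<le> a" and SL: "S (L t) = t" if "0 \<le> t" for t
    using surj[OF that] LS by auto
  have dL: "(L has_real_derivative - \<phi> (L t)) (at t)" if "0 \<le> t" for t
  proof -
    let ?u = "L t"
    have u: "z < ?u" using L_range[OF that] by simp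
    have "(L has_derivative (*) (- \<phi> ?u)) (at (S ?u))"
    proof (rule has_derivative_inverse_strong[where S="{z<..}" and f=S and f'="(*) (- 1 / \<phi> ?u)"])
      show "continuous_on {z<..} S"
        using contS by (auto intro!: continuous_at_imp_continuous_on)
      show "(S has_derivative (*) (- 1 / \<phi> ?u)) (at ?u)"
        using dS[OF u] by (simp add: has_field_derivative_def)
      show "(*) (- 1 / \<phi> ?u) \<circ> (*) (- \<phi> ?u) = id"
        using pos[OF u] by (auto simp: fun_eq_iff)
    qed (use u LS in auto)
    then show ?thesis
      by (simp add: has_field_derivative_def SL[OF that])
  qed
  have "(L \<longlongrightarrow> z) at_top"
  proof (rule order_tendstoI)
    fix e assume e: "e < z"
    show "\<forall>\<^sub>F t in at_top. e < L t"
      using eventually_ge_at_top[of "0::real"] by eventually_elim (use L_range e less_trans in blast)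
  next
    fix e assume e: "z < e"
    show "\<forall>\<^sub>F t in at_top. L t < e"
      using eventually_gt_at_top[of "max 0 (S e)"]
    proof eventually_elim
      case (elim t)
      then have "S e < S (L t)" using SL[of t] by simp
      then show ?case
        using S_dec[OF e, of "L t"] by (cases "L t" e rule: linorder_cases) auto
    qed
  qed
  moreover have "L 0 = a" using LS[OF za] S_a by simp
  ultimately show ?thesis using L_range dL by blast
qed

lemma decreasing_bounded_below_tendsto:
  fixes E :: "real \<Rightarrow> real"
  assumes dec: "\<And>s t. 0 \<le> s \<Longrightarrow> s \<le> t \<Longrightarrow> E t \<le> E s" and bound: "\<And>t. 0 \<le> t \<Longrightarrow> b \<le> E t"
  shows "\<exists>l. (E \<longlongrightarrow> l) at_top"
proof -
  \<comment> \<open>The sign change and \<open>max 0\<close> give a monotone function on the whole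
    line, as the passage from sequences to \<open>at_top\<close> requires.\<close>
  define f where "f t = - E (max 0 t)" for t
  have mono: "mono f"
    unfolding f_def by (intro monoI) (auto intro!: dec)
  have "incseq (\<lambda>n. f (real n))"
    using mono by (auto simp: incseq_def mono_def)
  moreover have "f (real n) \<le> - b" for n
    unfolding f_def using bound[of "max 0 (real n)"] by simp
  ultimately obtain l where "(\<lambda>n. f (real n)) \<longlonglongrightarrow> l"
    using incseq_convergent by blast
  then have "(f \<longlongrightarrow> l) at_top"
    using mono by (intro tendsto_at_topI_sequentially_real) (auto simp: mono_def)
  then have "((\<lambda>t. - f t) \<longlongrightarrow> - l) at_top"
    by (rule tendsto_minus)
  moreover have "\<forall>\<^sub>F t in at_top. - f t = E t"
    using eventually_ge_at_top[of "0::real"] by eventually_elim (simp add: f_def)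
  ultimately have "(E \<longlongrightarrow> - l) at_top"
    by (rule Lim_transform_eventually)
  then show ?thesis by blast
qed

text \<open>\<open>z\<close> is the limit of \<open>L\<close>, and \<open>p_eq\<close> is the
  conservation of \<open>H = p / L + ln L\<close>, solved for \<open>p\<close>.\<close>

locale DR_flow =
  fixes p L :: "real \<Rightarrow> real" and z lam H :: real
  assumes z: "0 \<le> z"
    and p_range: "\<And>t. 0 \<le> t \<Longrightarrow> 0 \<le> p t \<and> p t < 1"
    and L_range: "\<And>t. 0 \<le> t \<Longrightarrow> z < L t \<and> L t \<le> lam"
    and p_eq: "\<And>t. 0 \<le> t \<Longrightarrow> p t = L t * (H - ln (L t))"
    and dp: "\<And>t. 0 \<le> t \<Longrightarrow> (p has_real_derivative (1 - p t) * (L t - p t)) (at t)"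
    and dL: "\<And>t. 0 \<le> t \<Longrightarrow> (L has_real_derivative - ((1 - p t) * L t)) (at t)"
    and L_lim: "(L \<longlongrightarrow> z) at_top"
begin

lemma L_pos: "0 \<le> t \<Longrightarrow> 0 < L t"
  using L_range[of t] z by simp

definition mean :: "real \<Rightarrow> real" where "mean t = (1 - p t) / L t"

lemma mean_pos: "0 \<le> t \<Longrightarrow> 0 < mean t"
  using p_range[of t] L_pos[of t] by (simp add: mean_def)

lemma DERIV_mean:
  assumes "0 \<le> t"
  shows "(mean has_real_derivative mean t * (1 - L t)) (at t)"
  unfolding mean_def[abs_def] using L_pos[OF assms]
  by (auto intro!: derivative_eq_intros dp dL assms simp: field_simps power2_eq_square)

text \<open>The derivative is \<open>- L t\<close> times the function itself, so the function
  decreases and stays positive. This covers all three regimes at once.\<close>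

lemma mean_tendsto: "\<exists>l. ((\<lambda>t. exp (- t) * mean t) \<longlongrightarrow> l) at_top"
proof (rule decreasing_bounded_below_tendsto[where b=0])
  fix s t :: real assume st: "0 \<le> s" "s \<le> t"
  show "exp (- t) * mean t \<le> exp (- s) * mean s"
  proof (rule DERIV_nonpos_imp_nonincreasing[OF st(2)])
    fix x assume "s \<le> x" "x \<le> t"
    then have x: "0 \<le> x" using st by simp
    have "((\<lambda>t. exp (- t) * mean t) has_real_derivative - (exp (- x) * mean x * L x)) (at x)"
      by (auto intro!: derivative_eq_intros DERIV_mean x simp: algebra_simps)
    then show "\<exists>d. ((\<lambda>t. exp (- t) * mean t) has_real_derivative d) (at x) \<and> d \<le> 0"
      using mean_pos[OF x] L_pos[OF x] by (intro exI[of _ "- (exp (- x) * mean x * L x)"]) auto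
  qed
next
  fix t :: real assume "0 \<le> t"
  then show "0 \<le> exp (- t) * mean t" using mean_pos[of t] by simp
qed

text \<open>The hypothesis \<open>rate\<close> forces \<open>L t - z\<close> to decay like
  \<open>exp (- c * t)\<close>. The logarithm \<open>E\<close> of the renormalised mean has
  derivative \<open>z - L t\<close>, which is then integrable, so \<open>E\<close> has a finite
  limit and \<open>C\<close> is its exponential.\<close>

lemma mean_exponential_asymptotics:
  assumes c: "0 < c" and rate: "\<And>t. 0 \<le> t \<Longrightarrow> c * (L t - z) \<le> L t * (1 - p t)"
  shows "\<exists>C>0. ((\<lambda>t. exp ((z - 1) * t) * mean t) \<longlongrightarrow> C) at_top"
proof -
  define A where "A = L 0 - z"
  have L_decay: "L t - z \<le> A * exp (- c * t)" if t: "0 \<le> t" for t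
  proof -
    have "(L t - z) * exp (c * t) \<le> (L 0 - z) * exp (c * 0)"
    proof (rule DERIV_nonpos_imp_nonincreasing[OF t])
      fix x assume x: "0 \<le> x" "x \<le> t"
      have "((\<lambda>t. (L t - z) * exp (c * t)) has_real_derivative
          (c * (L x - z) - L x * (1 - p x)) * exp (c * x)) (at x)"
        by (auto intro!: derivative_eq_intros dL x simp: algebra_simps)
      then show "\<exists>d. ((\<lambda>t. (L t - z) * exp (c * t)) has_real_derivative d) (at x) \<and> d \<le> 0"
        using rate[OF x(1)]
        by (intro exI[of _ "(c * (L x - z) - L x * (1 - p x)) * exp (c * x)"])
          (auto intro!: mult_nonpos_nonneg)
    qed
    then show ?thesis
      by (simp add: A_def exp_minus field_simps)
  qed
  have A: "0 \<le> A" using L_range[of 0] by (simp add: A_def)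
  define E where "E t = ln (mean t) + (z - 1) * t" for t
  have dE: "(E has_real_derivative z - L t) (at t)" if "0 \<le> t" for t
    unfolding E_def[abs_def] using mean_pos[OF that]
    by (auto intro!: derivative_eq_intros DERIV_mean that)
  have "\<exists>l. (E \<longlongrightarrow> l) at_top"
  proof (rule decreasing_bounded_below_tendsto)
    fix s t :: real assume st: "0 \<le> s" "s \<le> t"
    show "E t \<le> E s"
    proof (rule DERIV_nonpos_imp_nonincreasing[OF st(2)])
      fix x assume "s \<le> x" "x \<le> t"
      then show "\<exists>d. (E has_real_derivative d) (at x) \<and> d \<le> 0"
        using dE[of x] L_range[of x] st by (intro exI[of _ "z - L x"]) auto
    qed
  next
    fix t :: real assume t: "0 \<le> t"
    \<comment> \<open>The subtracted term contributes \<open>A * exp (- c * x)\<close> to the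
      derivative, which outweighs \<open>z - L x\<close>; this bounds \<open>E\<close>
      below.\<close>
    have "E 0 - A / c * exp (- c * 0) \<le> E t - A / c * exp (- c * t)"
    proof (rule DERIV_nonneg_imp_nondecreasing[OF t])
      fix x assume x: "0 \<le> x" "x \<le> t"
      have "((\<lambda>t. E t - A / c * exp (- c * t)) has_real_derivative z - L x + A * exp (- c * x)) (at x)"
        using c by (auto intro!: derivative_eq_intros dE x)
      then show "\<exists>d. ((\<lambda>t. E t - A / c * exp (- c * t)) has_real_derivative d) (at x) \<and> 0 \<le> d"
        using L_decay[OF x(1)] by (intro exI[of _ "z - L x + A * exp (- c * x)"]) auto
    qed
    moreover have "0 \<le> A / c * exp (- c * t)" using A c by simp
    ultimately show "E 0 - A / c \<le> E t" by simp
  qed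
  then obtain l where "(E \<longlongrightarrow> l) at_top" by blast
  then have "((\<lambda>t. exp (E t)) \<longlongrightarrow> exp l) at_top"
    by (rule tendsto_exp)
  moreover have "\<forall>\<^sub>F t in at_top. exp (E t) = exp ((z - 1) * t) * mean t"
    using eventually_ge_at_top[of "0::real"]
    by eventually_elim (simp add: E_def exp_add mean_pos)
  ultimately have "((\<lambda>t. exp ((z - 1) * t) * mean t) \<longlongrightarrow> exp l) at_top"
    by (rule Lim_transform_eventually)
  then show ?thesis by (intro exI[of _ "exp l"]) simp
qed

text \<open>For \<open>H = 1\<close> the positive mass \<open>G (L t)\<close> is asymptotic to
  \<open>(L t - 1)\<^sup>2 / 2\<close>. Hence the derivative of \<open>1 / (L t - 1)\<close> tends
  to 1/2, l'Hospital makes \<open>L t - 1\<close> asymptotic to \<open>2 / t\<close>, and the mean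
  \<open>G (L t) / L t\<close> follows.\<close>

lemma mean_critical_asymptotics:
  assumes z1: "z = 1" and H1: "H = 1"
  shows "mean \<sim>[at_top] (\<lambda>t. 2 / t\<^sup>2)"
proof -
  have L_right: "filterlim L (at_right 1) at_top"
    unfolding filterlim_at
  proof
    show "\<forall>\<^sub>F t in at_top. L t \<in> {1<..} \<and> L t \<noteq> 1"
      using eventually_ge_at_top[of "0::real"]
    proof eventually_elim
      case (elim t)
      then show ?case using L_range[of t] z1 by simp
    qed
  qed (use L_lim z1 in simp)
  define G where "G u = 1 - u * (1 - ln u)" for u :: real
  have pG: "1 - p t = G (L t)" if "0 \<le> t" for t
    using p_eq[OF that] by (simp add: G_def H1)
  have "((\<lambda>u. u * G u / (u - 1)\<^sup>2) \<longlongrightarrow> 1 / 2) (at_right 1)"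
    unfolding G_def by real_asymp
  from filterlim_compose[OF this L_right]
  have 1: "((\<lambda>t. (L t * G (L t) / (L t - 1)\<^sup>2) / 1) \<longlongrightarrow> 1 / 2) at_top" by simp
  have 2: "((\<lambda>t. (1 / (L t - 1)) / t) \<longlongrightarrow> 1 / 2) at_top"
  proof (rule lhospital_at_top_at_top[OF _ _ _ _ 1])
    show "\<forall>\<^sub>F t in at_top. ((\<lambda>t. 1 / (L t - 1)) has_real_derivative L t * G (L t) / (L t - 1)\<^sup>2) (at t)"
      using eventually_ge_at_top[of "0::real"]
    proof eventually_elim
      case (elim t)
      then have "L t - 1 \<noteq> 0" using L_range[of t] z1 by simp
      then show ?case
        using elim by (auto intro!: derivative_eq_intros dL simp: pG power2_eq_square)
    qed
  qed (auto intro!: filterlim_ident)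
  have 3: "((\<lambda>u. G u / u / (u - 1)\<^sup>2) \<longlongrightarrow> 1 / 2) (at_right 1)"
    unfolding G_def by real_asymp
  \<comment> \<open>The powers of \<open>L t - 1\<close> cancel, which leaves
    \<open>mean t / (2 / t\<^sup>2)\<close>; the limit \<open>1 / 2 / (1 / 2)\<^sup>2 / 2\<close> is
    1.\<close>
  have 4: "((\<lambda>t. G (L t) / L t / (L t - 1)\<^sup>2 / ((1 / (L t - 1)) / t)\<^sup>2 / 2) \<longlongrightarrow> 1 / 2 / (1 / 2)\<^sup>2 / 2) at_top"
    by (intro tendsto_intros filterlim_compose[OF 3 L_right] 2) auto
  have 5: "\<forall>\<^sub>F t in at_top. G (L t) / L t / (L t - 1)\<^sup>2 / ((1 / (L t - 1)) / t)\<^sup>2 / 2 = mean t / (2 / t\<^sup>2)"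
    using eventually_gt_at_top[of "0::real"]
  proof eventually_elim
    case (elim t)
    then have "L t - 1 \<noteq> 0" using L_range[of t] z1 by simp
    then show ?case
      using elim by (simp add: mean_def pG power_divide power_mult_distrib)
  qed
  have "((\<lambda>t. mean t / (2 / t\<^sup>2)) \<longlongrightarrow> 1) at_top"
    using tendsto_cong[OF 5] 4 by (simp add: power2_eq_square)
  then show ?thesis by (rule asymp_equivI')
qed

end

text \<open>Only the equation for \<open>L\<close> is solved; \<open>p\<close> is then defined by
  the conservation law, and its equation follows by differentiation.\<close>

lemma DR_flow_exists:
  assumes p0: "0 \<le> p0" "p0 < 1" and lam: "0 < lam" and z: "0 \<le> z" "z < lam"
    and H: "H = p0 / lam + ln lam"
    and pos: "\<And>u. z < u \<Longrightarrow> u \<le> lam \<Longrightarrow> u * (H - ln u) < 1"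
    and up: "\<And>u. z < u \<Longrightarrow> u \<le> lam \<Longrightarrow> u * (1 - u * (H - ln u)) \<le> K * (u - z)" and K: "0 < K"
  shows "\<exists>p L. p 0 = p0 \<and> L 0 = lam \<and> DR_flow p L z lam H"
proof -
  \<comment> \<open>\<open>min u lam\<close> freezes the right-hand side above \<open>lam\<close>:
    positivity is assumed only up to there, while \<open>autonomous_ode_decreasing\<close> asks for
    it on all of \<open>{z<..}\<close>.\<close>
  define \<phi> where "\<phi> u = min u lam * (1 - min u lam * (H - ln (min u lam)))" for u
  have "\<exists>L. L 0 = lam \<and>
    (\<forall>t\<ge>0. z < L t \<and> L t \<le> lam \<and> (L has_real_derivative - \<phi> (L t)) (at t)) \<and> (L \<longlongrightarrow> z) at_top"
  proof (rule autonomous_ode_decreasing)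
    fix u assume u: "z < u"
    then have "0 < min u lam" "z < min u lam" using z lam by auto
    then show "isCont \<phi> u" "0 < \<phi> u"
      unfolding \<phi>_def using pos[of "min u lam"] by (auto intro!: continuous_intros mult_pos_pos)
    show "\<phi> u \<le> K * (u - z)" if "u \<le> lam"
      using up[OF u that] that by (simp add: \<phi>_def min_absorb1)
  qed (use K z in auto)
  then obtain L where L0: "L 0 = lam" and Lr: "\<And>t. 0 \<le> t \<Longrightarrow> z < L t \<and> L t \<le> lam"
    and dL: "\<And>t. 0 \<le> t \<Longrightarrow> (L has_real_derivative - \<phi> (L t)) (at t)" and lim: "(L \<longlongrightarrow> z) at_top"
    by blast
  define p where "p t = L t * (H - ln (L t))" for t
  have \<phi>: "\<phi> (L t) = (1 - p t) * L t" if "0 \<le> t" for t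
    using Lr[OF that] by (simp add: \<phi>_def p_def min_absorb1)
  have Lpos: "0 < L t" if "0 \<le> t" for t
    using Lr[OF that] z by simp
  have dL': "(L has_real_derivative - ((1 - p t) * L t)) (at t)" if "0 \<le> t" for t
    using dL[OF that] \<phi>[OF that] by simp
  have "DR_flow p L z lam H"
  proof
    fix t :: real assume t: "0 \<le> t"
    have "ln (L t) \<le> ln lam" using Lpos[OF t] Lr[OF t] by simp
    moreover have "ln lam \<le> H" using H p0 lam by simp
    ultimately have "0 \<le> p t" unfolding p_def using Lpos[OF t] by simp
    then show "0 \<le> p t \<and> p t < 1"
      using pos[of "L t"] Lr[OF t] by (simp add: p_def)
    have "(p has_real_derivative - ((1 - p t) * L t) * (H - ln (L t)) - (- ((1 - p t) * L t) / L t) * L t) (at t)"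
      unfolding p_def[abs_def] using Lpos[OF t]
      by (auto intro!: derivative_eq_intros dL'[OF t, unfolded p_def] simp: field_simps)
    moreover have "- ((1 - p t) * L t) * (H - ln (L t)) - (- ((1 - p t) * L t) / L t) * L t = (1 - p t) * (L t - p t)"
      using Lpos[OF t] by (simp add: p_def field_simps)
    ultimately show "(p has_real_derivative (1 - p t) * (L t - p t)) (at t)" by simp
  qed (use z Lr dL' lim in \<open>auto simp: p_def\<close>)
  moreover have "p 0 = p0" using lam by (simp add: p_def L0 H)
  ultimately show ?thesis using L0 by blast
qed

section \<open>Identification and the three regimes\<close>

lemma DR_model_exp_mixture:
  assumes "DR_model (exp_mixture q lam) \<mu>" "DR_flow p L z lam H" "p 0 = q" "L 0 = lam" "0 \<le> t"
  shows "\<mu> t = exp_mixture (p t) (L t)"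
proof -
  interpret DR_flow p L z lam H by fact
  have "mild_DR (\<lambda>t. exp_mixture (p t) (L t))"
    by (rule mild_DR_exp_mixture[OF p_range L_pos dp dL])
  moreover have "\<mu> 0 = exp_mixture (p 0) (L 0)"
    using assms by (simp add: DR_model_def)
  ultimately show ?thesis
    using mild_DR_unique[OF DR_model_mild[OF assms(1)]] \<open>0 \<le> t\<close> by simp
qed

section \<open>Mean, conditioning and weak limits of the mixtures\<close>

lemma
  assumes "0 \<le> p" "p \<le> 1" "0 < lam"
  shows set_integrable_exp_mixture: "set_integrable (exp_mixture p lam) {0..} (\<lambda>x. x)"
    and mean_exp_mixture: "(LINT x:{0..}|exp_mixture p lam. x) = (1 - p) / lam"
proof -
  let ?D = "density lborel (exponential_density lam)"
  interpret D: prob_space ?D by (rule prob_space_exponential_density[OF assms(3)])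
  have "distributed ?D lborel (\<lambda>x. x) (exponential_density lam)"
    unfolding distributed_def by (auto intro!: distr_id2)
  then have D: "has_bochner_integral ?D (\<lambda>x. x) (1 / lam)"
    using D.has_bochner_integral_erlang_ith_moment[OF assms(3), of "\<lambda>x. x" 0 1] by simp
  have ae: "AE x in ?D. indicator {0..} x *\<^sub>R x = x"
    by (subst AE_density) (auto simp: exponential_density_def indicator_def)
  have "has_bochner_integral ?D (\<lambda>x. indicator {0..} x *\<^sub>R x) (1 / lam)"
    by (rule has_bochner_integral_cong_AE[THEN iffD2, OF _ _ ae D]) measurable
  then have int: "integrable ?D (\<lambda>x. indicator {0..} x *\<^sub>R x)"
    and eq: "(LINT x|?D. indicator {0..} x *\<^sub>R x) = 1 / lam"
    by (auto simp: has_bochner_integral_iff)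
  show "set_integrable (exp_mixture p lam) {0..} (\<lambda>x. x)"
    unfolding set_integrable_def using assms int by (intro integrable_exp_mixture) auto
  show "(LINT x:{0..}|exp_mixture p lam. x) = (1 - p) / lam"
    unfolding set_lebesgue_integral_def using assms int eq by (subst integral_exp_mixture) auto
qed

text \<open>Restricting to the positive half-line drops the atom and leaves \<open>1 - p\<close>
  times the exponential law; normalisation cancels the factor.\<close>

lemma uniform_measure_exp_mixture:
  assumes "0 \<le> p" "p < 1" "0 < lam"
  shows "uniform_measure (exp_mixture p lam) {0<..} = density lborel (exponential_density lam)"
proof (rule measure_eqI)
  let ?D = "density lborel (exponential_density lam)"
  interpret D: prob_space ?D by (rule prob_space_exponential_density[OF assms(3)])
  have null: "emeasure ?D {..0} = 0"
    using assms by (simp add: emeasure_erlang_density erlang_CDF_0)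
  have pos: "emeasure ?D ({0<..} \<inter> A) = emeasure ?D A" if "A \<in> sets borel" for A
  proof -
    have "emeasure ?D A = emeasure ?D ({0<..} \<inter> A \<union> {..0} \<inter> A)"
      by (intro arg_cong2[where f=emeasure] refl) auto
    also have "\<dots> = emeasure ?D ({0<..} \<inter> A)"
      using that null by (intro emeasure_Un_null_set) (auto simp: null_sets_def intro: emeasure_eq_0[of "{..0}"])
    finally show ?thesis by simp
  qed
  have D1: "emeasure ?D {0<..} = 1"
    using pos[of UNIV] D.emeasure_space_1 by simp
  fix A assume "A \<in> sets (uniform_measure (exp_mixture p lam) {0<..})"
  then have A: "A \<in> sets borel" by simp
  have "emeasure (uniform_measure (exp_mixture p lam) {0<..}) A =
      emeasure ?D A * ennreal (1 - p) / ennreal (1 - p)"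
    using A by (simp add: emeasure_exp_mixture pos D1 mult.commute)
  then show "emeasure (uniform_measure (exp_mixture p lam) {0<..}) A = emeasure ?D A"
    using assms by (simp add: ennreal_mult_divide_eq)
qed simp

text \<open>Since \<open>1 \<le> L t \<le> lam\<close>, dominated convergence applies with the bound
  \<open>lam * B * exp (- x)\<close> on the nonnegative half-line.\<close>

lemma weak_conv_exponential_density:
  fixes L :: "real \<Rightarrow> real"
  assumes L: "(L \<longlongrightarrow> 1) at_top" and range: "\<And>t. 0 \<le> t \<Longrightarrow> 1 \<le> L t \<and> L t \<le> lam"
  shows "weak_conv_filter (\<lambda>t. density lborel (exponential_density (L t)))
    (density lborel (exponential_density 1)) at_top"
  unfolding weak_conv_filter_def
proof (intro allI impI)
  fix f :: "real \<Rightarrow> real" assume f: "continuous_on UNIV f \<and> bounded (range f)"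
  then obtain B where B: "\<And>x. \<bar>f x\<bar> \<le> B" by (auto simp: bounded_iff)
  have [measurable]: "f \<in> borel_measurable borel"
    using f by (auto intro: borel_measurable_continuous_onI)
  have "((\<lambda>t. LINT x|lborel. exponential_density (L t) x * f x) \<longlongrightarrow>
      (LINT x|lborel. exponential_density 1 x * f x)) at_top"
  proof (rule integral_dominated_convergence_at_top[where M=lborel and
        s="\<lambda>t x. exponential_density (L t) x * f x" and f="\<lambda>x. exponential_density 1 x * f x" and
        w="\<lambda>x. lam * B * exponential_density 1 x"])
    interpret prob_space "density lborel (exponential_density 1)"
      by (rule prob_space_exponential_density) simp
    have "integrable (density lborel (exponential_density 1)) (\<lambda>_. 1 :: real)" by simp
    then have "integrable lborel (exponential_density 1)"
      by (subst (asm) integrable_density) (auto simp: exponential_density_nonneg)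
    then show "integrable lborel (\<lambda>x. lam * B * exponential_density 1 x)" by simp
    show "AE x in lborel. ((\<lambda>t. exponential_density (L t) x * f x) \<longlongrightarrow> exponential_density 1 x * f x) at_top"
      unfolding exponential_density_def
      by (intro AE_I2 tendsto_mult tendsto_const) (auto intro!: tendsto_eq_intros L)
    show "\<forall>\<^sub>F t in at_top. AE x in lborel. norm (exponential_density (L t) x * f x) \<le> lam * B * exponential_density 1 x"
      using eventually_ge_at_top[of "0::real"]
    proof eventually_elim
      case (elim t)
      have "\<bar>exponential_density (L t) x * f x\<bar> \<le> lam * B * exponential_density 1 x" for x
      proof (cases "x < 0")
        case False
        have "L t * exp (- x * L t) * \<bar>f x\<bar> \<le> lam * exp (- x * 1) * B"
          using range[OF elim] B[of x] False mult_left_mono[of 1 "L t" x]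
          by (intro mult_mono) auto
        then show ?thesis
          using range[OF elim] False by (simp add: exponential_density_def abs_mult mult_ac)
      qed (simp add: exponential_density_def)
      then show ?case by simp
    qed
  qed auto
  moreover have "(LINT x|density lborel (exponential_density l). f x) =
      (LINT x|lborel. exponential_density l x * f x)" if "0 < l" for l
    using that by (subst integral_density) (auto simp: exponential_density_nonneg)
  moreover have "\<forall>\<^sub>F t in at_top. (LINT x|lborel. exponential_density (L t) x * f x) =
      (LINT x|density lborel (exponential_density (L t)). f x)"
    using eventually_ge_at_top[of "0::real"]
  proof eventually_elim
    case (elim t)
    then show ?case
      using range[of t] by (subst integral_density) (auto simp: exponential_density_nonneg)
  qed
  ultimately show "((\<lambda>t. LINT x|density lborel (exponential_density (L t)). f x) \<longlongrightarrow>
      (LINT x|density lborel (exponential_density 1). f x)) at_top"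
    by (auto elim: Lim_transform_eventually)
qed

text \<open>Along the flow, \<open>H = p / L + ln L\<close> is conserved, so \<open>1 - p = pos_mass H L\<close>.\<close>

definition pos_mass :: "real \<Rightarrow> real \<Rightarrow> real" where
  "pos_mass H u = 1 - u * (H - ln u)"

text \<open>\<open>pos_mass H\<close> is convex and the left-hand side is its tangent line at
  \<open>v\<close>; the inequality reduces to \<open>ln y \<le> y - 1\<close> at
  \<open>y = v / u\<close>.\<close>

lemma pos_mass_tangent:
  assumes "0 < u" "0 < v"
  shows "pos_mass H v + (1 + ln v - H) * (u - v) \<le> pos_mass H u"
proof -
  have "ln (v / u) \<le> v / u - 1"
    using assms by (intro ln_le_minus_one) simp
  then have "u * ln (v / u) \<le> u * (v / u - 1)"
    using assms by (intro mult_left_mono) auto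
  then have "u * (ln v - ln u) \<le> v - u"
    using assms by (simp add: ln_div right_diff_distrib)
  then show ?thesis
    by (simp add: pos_mass_def algebra_simps)
qed

text \<open>At the root, \<open>H - ln x = 1 / x\<close>, so the tangent there has slope
  \<open>(x - 1) / x\<close>, which is positive.\<close>

lemma pos_mass_lower:
  assumes "1 < x" "pos_mass H x = 0" "x \<le> u"
  shows "(x - 1) / x * (u - x) \<le> pos_mass H u"
proof -
  have "H - ln x = 1 / x" using assms by (simp add: pos_mass_def field_simps)
  then have "1 + ln x - H = (x - 1) / x"
    using assms by (simp add: diff_divide_distrib)
  then show ?thesis
    using pos_mass_tangent[of u x H] assms by simp
qed

text \<open>Here the tangent is taken at \<open>u\<close> and evaluated at the root
  \<open>x\<close>, which bounds from above. This is the linear vanishing that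
  \<open>DR_flow_exists\<close> asks for.\<close>

lemma pos_mass_upper:
  assumes "1 \<le> x" "pos_mass H x = 0" "x \<le> u" "u \<le> lam" "0 \<le> H"
  shows "u * pos_mass H u \<le> lam * (1 + ln lam) * (u - x)"
proof -
  have "pos_mass H u \<le> (1 + ln u - H) * (u - x)"
    using pos_mass_tangent[of x u H] assms by (simp add: algebra_simps)
  also have "\<dots> \<le> (1 + ln lam) * (u - x)"
  proof (intro mult_right_mono)
    have "ln u \<le> ln lam" using assms by simp
    then show "1 + ln u - H \<le> 1 + ln lam" using assms by linarith
  qed (use assms in simp)
  finally have "u * pos_mass H u \<le> u * ((1 + ln lam) * (u - x))"
    using assms by (intro mult_left_mono) auto
  also have "\<dots> \<le> lam * ((1 + ln lam) * (u - x))"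
    using assms by (intro mult_right_mono mult_nonneg_nonneg) auto
  finally show ?thesis by (simp add: mult.assoc)
qed

text \<open>To the right of a root larger than 1, \<open>pos_mass_lower\<close> makes
  \<open>pos_mass H\<close> strictly positive.\<close>

lemma pos_mass_root_unique:
  assumes "1 < x" "pos_mass H x = 0" "1 < y" "pos_mass H y = 0"
  shows "x = y"
proof -
  have "\<not> x < y" if "1 < x" "pos_mass H x = 0" "pos_mass H y = 0" for x y
  proof
    assume "x < y"
    then have "0 < (x - 1) / x * (y - x)" using that by simp
    then show False using pos_mass_lower[OF that(1,2) less_imp_le[OF \<open>x < y\<close>]] that(3) by linarith
  qed
  then show ?thesis using assms by (meson linorder_neqE)
qed

section \<open>Transfer from the flow to the model\<close>

lemma DR_mean_flow:
  assumes DR: "DR_model (exp_mixture q lam) \<mu>" and F: "DR_flow p L z lam H"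
    and init: "p 0 = q" "L 0 = lam" and t: "0 \<le> t"
  shows "set_integrable (\<mu> t) {0..} (\<lambda>x. x)" "DR_mean \<mu> t = DR_flow.mean p L t"
proof -
  interpret DR_flow p L z lam H by fact
  show "set_integrable (\<mu> t) {0..} (\<lambda>x. x)" "DR_mean \<mu> t = mean t"
    unfolding DR_mean_def DR_model_exp_mixture[OF DR F init t] mean_def
    using p_range[OF t] L_pos[OF t]
    by (auto intro!: set_integrable_exp_mixture mean_exp_mixture)
qed

text \<open>\<open>DR_F_infty\<close> is a \<open>Lim\<close>, informative only once a limit exists;
  \<open>mean_tendsto\<close> provides one in every regime.\<close>

lemma DR_flow_F_infty:
  assumes DR: "DR_model (exp_mixture q lam) \<mu>" and F: "DR_flow p L z lam H"
    and init: "p 0 = q" "L 0 = lam"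
  shows "((\<lambda>t. exp (- t) * DR_mean \<mu> t) \<longlongrightarrow> DR_F_infty \<mu>) at_top"
    and "((\<lambda>t. exp (- t) * DR_flow.mean p L t) \<longlongrightarrow> C) at_top \<Longrightarrow> DR_F_infty \<mu> = C"
proof -
  interpret DR_flow p L z lam H by fact
  have ev: "\<forall>\<^sub>F t in at_top. exp (- t) * mean t = exp (- t) * DR_mean \<mu> t"
    using eventually_ge_at_top[of "0::real"]
    by eventually_elim (simp add: DR_mean_flow[OF DR F init])
  have lim: "((\<lambda>t. exp (- t) * DR_mean \<mu> t) \<longlongrightarrow> l) at_top \<and> DR_F_infty \<mu> = l"
    if "((\<lambda>t. exp (- t) * mean t) \<longlongrightarrow> l) at_top" for l
  proof -
    have "((\<lambda>t. exp (- t) * DR_mean \<mu> t) \<longlongrightarrow> l) at_top"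
      using ev by (rule Lim_transform_eventually[OF that])
    then show ?thesis
      unfolding DR_F_infty_def using tendsto_Lim[OF trivial_limit_at_top_linorder] by blast
  qed
  show "((\<lambda>t. exp (- t) * DR_mean \<mu> t) \<longlongrightarrow> DR_F_infty \<mu>) at_top"
  proof -
    obtain l where "((\<lambda>t. exp (- t) * mean t) \<longlongrightarrow> l) at_top" using mean_tendsto by blast
    from lim[OF this] show ?thesis by simp
  qed
  show "DR_F_infty \<mu> = C" if "((\<lambda>t. exp (- t) * mean t) \<longlongrightarrow> C) at_top"
    using lim[OF that] by simp
qed

text \<open>On P, \<open>pos_mass\<close> stays away from zero on the whole range of
  \<open>L\<close>, so \<open>L\<close> decreases to 0; the bound \<open>c\<close> later serves as
  exponential rate.\<close>

lemma DR_P_flow: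
  assumes q: "0 \<le> q" "q < 1" and lam: "0 < lam" and P: "(q, lam) \<in> DR_P"
  obtains p L c where "p 0 = q" "L 0 = lam" "DR_flow p L 0 lam (q / lam + ln lam)" "0 < c"
    "\<And>u. 0 < u \<Longrightarrow> u \<le> lam \<Longrightarrow> c \<le> pos_mass (q / lam + ln lam) u"
proof -
  define H where "H = q / lam + ln lam"
  have pos_mass_lam: "pos_mass H lam = 1 - q" using lam by (simp add: pos_mass_def H_def)
  have "\<exists>c>0. \<forall>u. 0 < u \<longrightarrow> u \<le> lam \<longrightarrow> c \<le> pos_mass H u"
  proof (cases "H < 1")
    case True
    \<comment> \<open>\<open>exp (H - 1)\<close> is the minimum point of the convex function
      \<open>pos_mass H\<close>, with value \<open>1 - exp (H - 1)\<close>.\<close>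
    have "1 - exp (H - 1) \<le> pos_mass H u" if "0 < u" for u
      using pos_mass_tangent[of u "exp (H - 1)" H] that by (simp add: pos_mass_def algebra_simps)
    then show ?thesis using True by (intro exI[of _ "1 - exp (H - 1)"]) auto
  next
    case False
    have "lam < 1"
    proof (rule ccontr)
      assume "\<not> lam < 1"
      then have "q < lam - lam * ln lam" using P by (auto simp: DR_P_def)
      then have "H < 1" using lam by (simp add: H_def field_simps)
      then show False using False by simp
    qed
    \<comment> \<open>The tangent at \<open>lam\<close> has slope at most 0, so to the left of
      \<open>lam\<close> the function is at least its value \<open>1 - q\<close> there.\<close>
    have "1 - q \<le> pos_mass H u" if "0 < u" "u \<le> lam" for u
    proof -
      have "ln lam < 0" using lam \<open>lam < 1\<close> by simp
      then have "1 + ln lam - H \<le> 0" using False by linarith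
      then have "0 \<le> (1 + ln lam - H) * (u - lam)"
        using that by (intro mult_nonpos_nonpos) auto
      then show ?thesis using pos_mass_tangent[of u lam H] that lam pos_mass_lam by simp
    qed
    then show ?thesis using q by (intro exI[of _ "1 - q"]) auto
  qed
  then obtain c where c: "0 < c" "\<And>u. 0 < u \<Longrightarrow> u \<le> lam \<Longrightarrow> c \<le> pos_mass H u" by blast
  have "\<exists>p L. p 0 = q \<and> L 0 = lam \<and> DR_flow p L 0 lam H"
  proof (rule DR_flow_exists[where K=1])
    fix u assume u: "0 < u" "u \<le> lam"
    show "u * (H - ln u) < 1" using c(2)[OF u] c(1) by (simp add: pos_mass_def)
    have "ln u \<le> ln lam" using u by simp
    also have "ln lam \<le> H" using lam q by (simp add: H_def)
    finally have "0 \<le> u * (H - ln u)" using u by simp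
    then show "u * (1 - u * (H - ln u)) \<le> 1 * (u - 0)"
      using u by (simp add: mult_left_le)
  qed (use q lam H_def in auto)
  then show ?thesis using that c unfolding H_def by blast
qed

text \<open>Shared by U, where \<open>1 < x\<close>, and C, where \<open>x = 1\<close>:
  \<open>L\<close> starts at \<open>lam\<close> and descends to the root.\<close>

lemma DR_root_flow:
  assumes q: "0 \<le> q" "q < 1" and lam: "0 < lam" and x: "1 \<le> x" "x < lam"
    and H: "H = q / lam + ln lam" and root: "pos_mass H x = 0"
    and pos: "\<And>u. x < u \<Longrightarrow> u \<le> lam \<Longrightarrow> 0 < pos_mass H u"
  obtains p L where "p 0 = q" "L 0 = lam" "DR_flow p L x lam H"
proof -
  have "0 \<le> H" using H q lam x by simp
  have "\<exists>p L. p 0 = q \<and> L 0 = lam \<and> DR_flow p L x lam H"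
  proof (rule DR_flow_exists[where K="lam * (1 + ln lam)"])
    show "0 < lam * (1 + ln lam)" using lam x by (simp add: add_pos_pos)
    fix u assume u: "x < u" "u \<le> lam"
    show "u * (H - ln u) < 1" using pos[OF u] by (simp add: pos_mass_def)
    show "u * (1 - u * (H - ln u)) \<le> lam * (1 + ln lam) * (u - x)"
      using pos_mass_upper[of x H u lam] u x root \<open>0 \<le> H\<close> by (simp add: pos_mass_def)
  qed (use assms in auto)
  then show ?thesis using that by blast
qed

text \<open>\<open>pos_mass H\<close> is \<open>1 - H < 0\<close> at 1 and \<open>1 - q > 0\<close>
  at \<open>lam\<close>. That the root lies below \<open>lam\<close> is what lets the flow descend
  to it.\<close>

lemma DR_U_root:
  assumes q: "q < 1" and lam: "1 \<le> lam" and H: "H = q / lam + ln lam" "1 < H"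
  obtains x where "1 < x" "x < lam" "pos_mass H x = 0"
proof -
  have G1: "pos_mass H 1 < 0" using H by (simp add: pos_mass_def)
  have Gl: "0 < pos_mass H lam" using H lam q by (simp add: pos_mass_def)
  have "\<forall>x. 1 \<le> x \<and> x \<le> lam \<longrightarrow> isCont (pos_mass H) x"
    unfolding pos_mass_def[abs_def] by (auto intro!: continuous_intros)
  then obtain x where "1 \<le> x" "x \<le> lam" "pos_mass H x = 0"
    using IVT[of "pos_mass H" 1 0 lam] G1 Gl lam by auto
  moreover have "x \<noteq> 1" "x \<noteq> lam" using G1 Gl \<open>pos_mass H x = 0\<close> by auto
  ultimately show ?thesis using that[of x] by simp
qed

lemma pos_mass_root_iff: "pos_mass H x = 0 \<longleftrightarrow> H * x - x * ln x = 1"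
  by (auto simp: pos_mass_def algebra_simps)

text \<open>For \<open>H = 1\<close> the tangent at the root 1 is horizontal, so strictness comes
  from the equality case of \<open>ln y \<le> y - 1\<close>, which is \<open>y = 1\<close>
  only.\<close>

lemma pos_mass_1_pos:
  assumes "1 < u"
  shows "0 < pos_mass 1 u"
proof -
  have "ln (1 / u) \<noteq> 1 / u - 1"
    using ln_eq_minus_one[of "1 / u"] assms by auto
  then have "ln (1 / u) < 1 / u - 1"
    using ln_le_minus_one[of "1 / u"] assms by simp
  then have "u * ln (1 / u) < u * (1 / u - 1)"
    using assms by (intro mult_strict_left_mono) auto
  then show ?thesis
    using assms by (simp add: pos_mass_def ln_div right_diff_distrib)
qed

theorem theorem1p9:
  fixes p lam :: real and \<mu> :: "real \<Rightarrow> real measure"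
  assumes "0 \<le> p" and "p < 1" and "0 < lam"
    and "DR_model (exp_mixture p lam) \<mu>"
  shows "(\<forall>t\<ge>0. set_integrable (\<mu> t) {0..} (\<lambda>x. x))
    \<and> ((\<lambda>t. exp (- t) * DR_mean \<mu> t) \<longlongrightarrow> DR_F_infty \<mu>) at_top
    \<and> ((p, lam) \<in> DR_P \<longrightarrow> 0 < DR_F_infty \<mu>)
    \<and> ((p, lam) \<in> DR_U \<longrightarrow>
         (let H = p / lam + ln lam in
           (\<exists>!x. 1 < x \<and> H * x - x * ln x = 1) \<and>
           (\<forall>x. 1 < x \<and> H * x - x * ln x = 1 \<longrightarrow>
              (\<exists>C>0. DR_mean \<mu> \<sim>[at_top] (\<lambda>t. C * exp (- ((x - 1) * t)))))))
    \<and> ((p, lam) \<in> DR_C \<longrightarrow>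
         DR_mean \<mu> \<sim>[at_top] (\<lambda>t. 2 / t\<^sup>2) \<and>
         weak_conv_filter (\<lambda>t. uniform_measure (\<mu> t) {0<..})
           (density lborel (exponential_density 1)) at_top)"
proof -
  define H where "H = p / lam + ln lam"
  note DR = assms(4)
  \<comment> \<open>\<open>?basic\<close> holds in every regime, but the flow is built separately in
    each, so it is proved along with each case; the three sets cover all admissible
    parameters.\<close>
  let ?basic = "(\<forall>t\<ge>0. set_integrable (\<mu> t) {0..} (\<lambda>x. x)) \<and>
    ((\<lambda>t. exp (- t) * DR_mean \<mu> t) \<longlongrightarrow> DR_F_infty \<mu>) at_top"
  let ?U = "(\<exists>!x. 1 < x \<and> H * x - x * ln x = 1) \<and> (\<forall>x. 1 < x \<and> H * x - x * ln x = 1 \<longrightarrow>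
      (\<exists>C>0. DR_mean \<mu> \<sim>[at_top] (\<lambda>t. C * exp (- ((x - 1) * t)))))"
  let ?C = "DR_mean \<mu> \<sim>[at_top] (\<lambda>t. 2 / t\<^sup>2) \<and>
    weak_conv_filter (\<lambda>t. uniform_measure (\<mu> t) {0<..}) (density lborel (exponential_density 1)) at_top"
  have basic: "?basic" if "DR_flow q L z lam H" "q 0 = p" "L 0 = lam" for q L z
    using DR_mean_flow(1)[OF DR that] DR_flow_F_infty(1)[OF DR that] by blast
  have "?basic \<and> 0 < DR_F_infty \<mu>" if P: "(p, lam) \<in> DR_P"
  proof -
    obtain q L c where F: "q 0 = p" "L 0 = lam" "DR_flow q L 0 lam H" and c: "0 < c"
      "\<And>u. 0 < u \<Longrightarrow> u \<le> lam \<Longrightarrow> c \<le> pos_mass H u"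
      using DR_P_flow[OF assms(1-3) P] unfolding H_def by metis
    interpret DR_flow q L 0 lam H by (rule F(3))
    have "\<exists>C>0. ((\<lambda>t. exp ((0 - 1) * t) * mean t) \<longlongrightarrow> C) at_top"
    proof (rule mean_exponential_asymptotics[OF c(1)])
      fix t :: real assume t: "0 \<le> t"
      have "c \<le> 1 - q t"
        using c(2)[of "L t"] L_range[OF t] p_eq[OF t] by (simp add: pos_mass_def)
      then show "c * (L t - 0) \<le> L t * (1 - q t)"
        using L_pos[OF t] by (simp add: mult.commute)
    qed
    then obtain C where "0 < C" "((\<lambda>t. exp (- t) * mean t) \<longlongrightarrow> C) at_top" by auto
    then show ?thesis
      using basic[OF F(3,1,2)] DR_flow_F_infty(2)[OF DR F(3,1,2)] by simp
  qed
  moreover have "?basic \<and> ?U" if U: "(p, lam) \<in> DR_U"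
  proof -
    have lam: "1 \<le> lam" and "p > lam - lam * ln lam" using U by (auto simp: DR_U_def)
    then have "1 < H" using assms(3) by (simp add: H_def field_simps)
    then obtain x where x: "1 < x" "x < lam" "pos_mass H x = 0"
      using DR_U_root[OF assms(2) lam H_def] by metis
    have "0 < pos_mass H u" if "x < u" for u
    proof -
      have "0 < (x - 1) / x * (u - x)" using that x by simp
      then show ?thesis using pos_mass_lower[OF x(1,3) less_imp_le[OF that]] by linarith
    qed
    then obtain q L where F: "q 0 = p" "L 0 = lam" "DR_flow q L x lam H"
      using DR_root_flow[OF assms(1-3) _ x(2) H_def x(3)] x(1) by (metis less_imp_le)
    interpret DR_flow q L x lam H by (rule F(3))
    have "\<exists>C>0. ((\<lambda>t. exp ((x - 1) * t) * mean t) \<longlongrightarrow> C) at_top"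
    proof (rule mean_exponential_asymptotics)
      fix t :: real assume t: "0 \<le> t"
      have "(x - 1) / x * (L t - x) \<le> 1 - q t"
        using pos_mass_lower[of x H "L t"] x L_range[OF t] p_eq[OF t] by (simp add: pos_mass_def)
      \<comment> \<open>The factor \<open>L t\<close>, at least \<open>x\<close>, turns the slope
        \<open>(x - 1) / x\<close> into the rate \<open>x - 1\<close>.\<close>
      then have "x * ((x - 1) / x * (L t - x)) \<le> L t * (1 - q t)"
        using x L_range[OF t] p_range[OF t] by (intro mult_mono) auto
      then show "(x - 1) * (L t - x) \<le> L t * (1 - q t)"
        using x by simp
    qed (use x in simp)
    then obtain C where C: "0 < C" "((\<lambda>t. exp ((x - 1) * t) * mean t) \<longlongrightarrow> C) at_top" by auto
    have "((\<lambda>t. exp ((x - 1) * t) * mean t / C) \<longlongrightarrow> C / C) at_top"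
      using C by (intro tendsto_divide tendsto_const) auto
    moreover have "\<forall>\<^sub>F t in at_top. exp ((x - 1) * t) * mean t / C = DR_mean \<mu> t / (C * exp (- ((x - 1) * t)))"
      using eventually_ge_at_top[of "0::real"]
      by eventually_elim (use C in \<open>simp add: DR_mean_flow(2)[OF DR F(3,1,2)] exp_minus divide_inverse mult_ac\<close>)
    ultimately have "((\<lambda>t. DR_mean \<mu> t / (C * exp (- ((x - 1) * t)))) \<longlongrightarrow> C / C) at_top"
      by (rule Lim_transform_eventually)
    then have "DR_mean \<mu> \<sim>[at_top] (\<lambda>t. C * exp (- ((x - 1) * t)))"
      using C(1) by (intro asymp_equivI') simp
    moreover have "y = x" if "1 < y \<and> H * y - y * ln y = 1" for y
      using pos_mass_root_unique[of y H x] that x by (simp add: pos_mass_root_iff)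
    moreover have "H * x - x * ln x = 1" using x(3) by (simp add: pos_mass_root_iff)
    ultimately show ?thesis
      using basic[OF F(3,1,2)] x(1) C(1) by blast
  qed
  moreover have "?basic \<and> ?C" if C: "(p, lam) \<in> DR_C"
  proof -
    have lam: "1 \<le> lam" and p: "p = lam - lam * ln lam" using C by (auto simp: DR_C_def)
    have H1: "H = 1" using assms(3) by (simp add: H_def p field_simps)
    \<comment> \<open>At \<open>lam = 1\<close> the critical equation would force
      \<open>p = 1\<close>.\<close>
    have "lam \<noteq> 1" using p assms(2) by auto
    then have lam1: "1 < lam" using lam by simp
    have "pos_mass H 1 = 0" by (simp add: pos_mass_def H1)
    moreover have "0 < pos_mass H u" if "1 < u" for u using pos_mass_1_pos[OF that] H1 by simp
    ultimately obtain q L where F: "q 0 = p" "L 0 = lam" "DR_flow q L 1 lam H"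
      using DR_root_flow[OF assms(1-3) order_refl lam1 H_def] by metis
    interpret DR_flow q L 1 lam H by (rule F(3))
    have "DR_mean \<mu> \<sim>[at_top] mean"
      by (intro asymp_equiv_refl_ev eventually_mono[OF eventually_ge_at_top[of "0::real"]]
          DR_mean_flow(2)[OF DR F(3,1,2)])
    also have "mean \<sim>[at_top] (\<lambda>t. 2 / t\<^sup>2)"
      using H1 by (intro mean_critical_asymptotics) auto
    finally have 1: "DR_mean \<mu> \<sim>[at_top] (\<lambda>t. 2 / t\<^sup>2)" .
    have W: "weak_conv_filter (\<lambda>t. density lborel (exponential_density (L t)))
        (density lborel (exponential_density 1)) at_top"
      using L_range by (intro weak_conv_exponential_density[OF L_lim]) (auto intro: less_imp_le)
    \<comment> \<open>\<open>\<mu> t\<close> is identified only for \<open>0 \<le> t\<close>, so the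
      integrals agree only eventually.\<close>
    have ev: "\<forall>\<^sub>F t in at_top. (LINT x|density lborel (exponential_density (L t)). f x) =
        (LINT x|uniform_measure (\<mu> t) {0<..}. f x)" for f :: "real \<Rightarrow> real"
      using eventually_ge_at_top[of "0::real"]
    proof eventually_elim
      case (elim t)
      then show ?case
        using p_range[of t] L_pos[of t]
        by (simp add: DR_model_exp_mixture[OF DR F(3,1,2)] uniform_measure_exp_mixture)
    qed
    have "weak_conv_filter (\<lambda>t. uniform_measure (\<mu> t) {0<..}) (density lborel (exponential_density 1)) at_top"
      using W Lim_transform_eventually[OF _ ev] unfolding weak_conv_filter_def by blast
    then show ?thesis using 1 basic[OF F(3,1,2)] by blast
  qed
  moreover have "(p, lam) \<in> DR_P \<or> (p, lam) \<in> DR_U \<or> (p, lam) \<in> DR_C"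
    using assms(1-3) unfolding DR_P_def DR_U_def DR_C_def by (auto simp: not_less)
  ultimately show ?thesis
    unfolding H_def Let_def by blast
qed

end
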